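(* Let $\Omega\Subset\mathbb{C}^n$ be a smooth bounded strongly pseudoconvex domain. The Mabuchi space $\mathcal{H}$ of plurisubharmonic functions in $\Omega$, equipped with the Levi-Civita connection $D$ of the Mabuchi metric, is a locally symmetric space; that is, the curvature tensor $R$ of $D$ is parallel: $DR=0$.
   Context: Conventions: $d=\partial+\bar\partial$, $d^c=\frac{i}{2\pi}(\bar\partial-\partial)$. Mabuchi space: $\mathcal{H}=\{\varphi\in C^\infty(\bar\Omega,\mathbb{R}) : dd^c\varphi>0 \text{ in } \bar\Omega,\ \varphi=0 \text{ on } \partial\Omega\}$. Its tangent space at $\varphi$ is identified with $T_\varphi\mathcal{H}=\{\xi\in C^\infty(\bar\Omega,\mathbb{R}) : \xi=0\text{ on }\partial\Omega\}$. The Mabuchi metric is $\langle\langle\psi_1,\psi_2\rangle\rangle_\varphi=\int_\Omega\psi_1\psi_2\,(dd^c\varphi)^n$ for $\varphi\in\mathcal{H}$ and $\psi_1,\psi_2\in T_\varphi\mathcal{H}$. Connection: the covariant derivative of a vector field $\psi_t$ along a path $\varphi_t$ in $\mathcal{H}$ is $D\psi=\frac{d\psi}{dt}-\langle\nabla\psi,\nabla\dot\varphi\rangle_\varphi$, where $\nabla$ and $\langle\cdot,\cdot\rangle_\varphi$ are the gradient and scalar product relative to the metric $\omega_\varphi=dd^c\varphi$, normalized so that $\langle\nabla f,\nabla g\rangle_\varphi\,(dd^c\varphi)^n=n\,df\wedge d^cg\wedge(dd^c\varphi)^{n-1}$. For families depending on several parameters, $D_t,D_s,D_r$ denote covariant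 differentiation in the corresponding parameter, e.g. $D_s\psi=\psi_s-\langle\nabla\psi,\nabla\varphi_s\rangle_\varphi$, and $\varphi_t,\varphi_s$ denote the derivatives of $\varphi$ in $t$ and $s$. Curvature: for a 2-parameter family $\varphi(t,s)\in\mathcal{H}$ and a vector field $\psi(t,s)\in T_\varphi\mathcal{H}$ along it, $R_\varphi(\varphi_t,\varphi_s)\psi=D_tD_s\psi-D_sD_t\psi$. Locally symmetric: the connection $D$ on $\mathcal{H}$ is called locally symmetric if its curvature tensor is parallel, i.e. $DR=0$, where for a 3-parameter family $\varphi(t,s,r)$ in $\mathcal{H}$ and a vector field $\psi$ along it $$(D_rR_{\varphi})(\varphi_t,\varphi_s)\psi=D_r\big(R_{\varphi}(\varphi_t,\varphi_s)\psi\big)-R_{\varphi}(D_r\varphi_t,\varphi_s)\psi-R_{\varphi}(\varphi_t,D_r\varphi_s)\psi-R_{\varphi}(\varphi_t,\varphi_s)(D_r\psi).$$ *)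

theory Defs
  imports "HOL-Analysis.Analysis"
begin

subsection \<open>Smooth functions\<close>

text \<open>These are meant for open sets: derivatives are taken in the full space.\<close>

primrec Ck_on :: "nat \<Rightarrow> ('a::euclidean_space \<Rightarrow> real) \<Rightarrow> 'a set \<Rightarrow> bool" where
  "Ck_on 0 f S \<longleftrightarrow> continuous_on S f"
| "Ck_on (Suc k) f S \<longleftrightarrow>
     (\<forall>x\<in>S. f differentiable (at x)) \<and> (\<forall>v. Ck_on k (\<lambda>x. frechet_derivative f (at x) v) S)"

definition smooth_on :: "('a::euclidean_space \<Rightarrow> real) \<Rightarrow> 'a set \<Rightarrow> bool" where
  "smooth_on f S \<longleftrightarrow> (\<forall>k. Ck_on k f S)"

text \<open>
  An element of \<open>C\<^sup>\<infinity>(closure \<Omega>)\<close> is represented by a total function that is smooth on some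
  open neighbourhood of \<open>closure \<Omega>\<close>.  Only its restriction to \<open>closure \<Omega>\<close> is meaningful.
  At points of \<open>closure \<Omega>\<close> all derivatives are determined by the values on \<open>\<Omega>\<close>, by
  continuity, so nothing below depends on the choice of the representative.
\<close>

definition smooth_closure :: "(complex^'n) set \<Rightarrow> (complex^'n \<Rightarrow> real) set" where
  "smooth_closure \<Omega> = {f. \<exists>U. open U \<and> closure \<Omega> \<subseteq> U \<and> smooth_on f U}"

text \<open>Families over a finite-dimensional parameter set, jointly smooth up to the boundary of \<open>\<Omega>\<close>.\<close>

definition smooth_family ::
    "'p::euclidean_space set \<Rightarrow> (complex^'n) set \<Rightarrow> ('p \<Rightarrow> complex^'n \<Rightarrow> real) \<Rightarrow> bool" where
  "smooth_family P \<Omega> F \<longleftrightarrow>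
     (\<exists>W. open W \<and> P \<times> closure \<Omega> \<subseteq> W \<and> smooth_on (\<lambda>(p, z). F p z) W)"

subsection \<open>The operators \<open>d\<close>, \<open>d\<^sup>c\<close> and \<open>dd\<^sup>c\<close>\<close>

text \<open>
  Differential forms at a point are regarded as real-multilinear functions of tangent vectors;
  the complex structure is multiplication by \<open>\<i>\<close>.
\<close>

definition dform :: "(complex^'n \<Rightarrow> real) \<Rightarrow> complex^'n \<Rightarrow> complex^'n \<Rightarrow> real" where
  "dform f z v = frechet_derivative f (at z) v"

definition partial_form :: "(complex^'n \<Rightarrow> real) \<Rightarrow> complex^'n \<Rightarrow> complex^'n \<Rightarrow> complex" where
  "partial_form f z v = (complex_of_real (dform f z v) - \<i> * complex_of_real (dform f z (\<i> *s v))) / 2"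

definition dbar_form :: "(complex^'n \<Rightarrow> real) \<Rightarrow> complex^'n \<Rightarrow> complex^'n \<Rightarrow> complex" where
  "dbar_form f z v = (complex_of_real (dform f z v) + \<i> * complex_of_real (dform f z (\<i> *s v))) / 2"

text \<open>The number under \<open>Re\<close> is real, because \<open>f\<close> is.\<close>

definition dc_form :: "(complex^'n \<Rightarrow> real) \<Rightarrow> complex^'n \<Rightarrow> complex^'n \<Rightarrow> real" where
  "dc_form f z v = Re (\<i> / (2 * complex_of_real pi) * (dbar_form f z v - partial_form f z v))"

text \<open>Exterior derivative of the 1-form \<open>d\<^sup>c f\<close>, evaluated on constant vector fields \<open>u\<close>, \<open>v\<close>.\<close>

definition ddc_form :: "(complex^'n \<Rightarrow> real) \<Rightarrow> complex^'n \<Rightarrow> complex^'n \<Rightarrow> complex^'n \<Rightarrow> real" where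
  "ddc_form f z u v = dform (\<lambda>w. dc_form f w v) z u - dform (\<lambda>w. dc_form f w u) z v"

definition ddc_pos :: "(complex^'n \<Rightarrow> real) \<Rightarrow> complex^'n \<Rightarrow> bool" where
  "ddc_pos f z \<longleftrightarrow> (\<forall>v. v \<noteq> 0 \<longrightarrow> ddc_form f z v (\<i> *s v) > 0)"

subsection \<open>Smooth bounded strongly pseudoconvex domains\<close>

text \<open>
  \<open>\<rho>\<close> is a local defining function near the boundary; its Levi form, here
  \<open>ddc_form \<rho> z v (\<i> *s v)\<close> up to a positive factor, has to be positive on the nonzero complex
  tangent vectors, i.e. those annihilated by \<open>\<partial>\<rho>\<close>.
\<close>

definition smooth_bounded_strongly_pseudoconvex :: "(complex^'n) set \<Rightarrow> bool" where
  "smooth_bounded_strongly_pseudoconvex \<Omega> \<longleftrightarrow>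
     open \<Omega> \<and> connected \<Omega> \<and> \<Omega> \<noteq> {} \<and> bounded \<Omega> \<and>
     (\<exists>U \<rho>. open U \<and> frontier \<Omega> \<subseteq> U \<and> smooth_on \<rho> U \<and>
        \<Omega> \<inter> U = {z \<in> U. \<rho> z < 0} \<and>
        (\<forall>z\<in>frontier \<Omega>. (\<exists>v. dform \<rho> z v \<noteq> 0) \<and>
           (\<forall>v. v \<noteq> 0 \<and> partial_form \<rho> z v = 0 \<longrightarrow> ddc_form \<rho> z v (\<i> *s v) > 0)))"

subsection \<open>The Mabuchi space and its connection\<close>

definition strictly_psh :: "(complex^'n) set \<Rightarrow> (complex^'n \<Rightarrow> real) set" where
  "strictly_psh \<Omega> = {\<phi> \<in> smooth_closure \<Omega>. \<forall>z\<in>closure \<Omega>. ddc_pos \<phi> z}"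

definition mabuchi_space :: "(complex^'n) set \<Rightarrow> (complex^'n \<Rightarrow> real) set" where
  "mabuchi_space \<Omega> = {\<phi> \<in> strictly_psh \<Omega>. \<forall>z\<in>frontier \<Omega>. \<phi> z = 0}"

definition mabuchi_tangent :: "(complex^'n) set \<Rightarrow> (complex^'n \<Rightarrow> real) set" where
  "mabuchi_tangent \<Omega> = {\<xi> \<in> smooth_closure \<Omega>. \<forall>z\<in>frontier \<Omega>. \<xi> z = 0}"

text \<open>
  The Riemannian metric of \<open>\<omega> = dd\<^sup>c \<phi>\<close> is a constant multiple of \<open>\<omega>(u, \<i>v)\<close>.  The constant
  \<open>2\<pi>\<close> is forced by the normalization
  \<open>\<langle>\<nabla>f,\<nabla>g\<rangle> \<omega>\<^sup>n = n df \<and> d\<^sup>c g \<and> \<omega>\<^sup>n\<^sup>-\<^sup>1\<close>: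
  with this constant the contraction of \<open>\<omega>\<close> by \<open>\<nabla>g\<close> is exactly \<open>d\<^sup>c g\<close>
  (as \<open>d\<^sup>c g(v) = - dg(\<i>v) / 2\<pi>\<close>), and contracting \<open>df \<and> \<omega>\<^sup>n = 0\<close> by \<open>\<nabla>g\<close> gives
  \<open>df(\<nabla>g) \<omega>\<^sup>n = n df \<and> d\<^sup>c g \<and> \<omega>\<^sup>n\<^sup>-\<^sup>1\<close>.
\<close>

definition kahler_metric :: "(complex^'n \<Rightarrow> real) \<Rightarrow> complex^'n \<Rightarrow> complex^'n \<Rightarrow> complex^'n \<Rightarrow> real" where
  "kahler_metric \<phi> z u v = 2 * pi * ddc_form \<phi> z u (\<i> *s v)"

definition kahler_grad :: "(complex^'n \<Rightarrow> real) \<Rightarrow> (complex^'n \<Rightarrow> real) \<Rightarrow> complex^'n \<Rightarrow> complex^'n" where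
  "kahler_grad \<phi> f z = (THE w. \<forall>v. kahler_metric \<phi> z w v = dform f z v)"

definition grad_inner ::
    "(complex^'n \<Rightarrow> real) \<Rightarrow> (complex^'n \<Rightarrow> real) \<Rightarrow> (complex^'n \<Rightarrow> real) \<Rightarrow> complex^'n \<Rightarrow> real" where
  "grad_inner \<phi> f g z = kahler_metric \<phi> z (kahler_grad \<phi> f z) (kahler_grad \<phi> g z)"

definition velocity :: "(real \<Rightarrow> complex^'n \<Rightarrow> real) \<Rightarrow> real \<Rightarrow> complex^'n \<Rightarrow> real" where
  "velocity \<psi> t z = deriv (\<lambda>\<tau>. \<psi> \<tau> z) t"

text \<open>
  The covariant derivative of \<open>\<psi>\<close> along the path \<open>\<phi>\<close>.  For fields vanishing on the boundary
  of \<open>\<Omega>\<close> the result need not vanish there, which is why the curvature below takes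
  arbitrary smooth functions as arguments.
\<close>

definition cov_deriv ::
    "(real \<Rightarrow> complex^'n \<Rightarrow> real) \<Rightarrow> (real \<Rightarrow> complex^'n \<Rightarrow> real) \<Rightarrow> real \<Rightarrow> complex^'n \<Rightarrow> real" where
  "cov_deriv \<phi> \<psi> t z = velocity \<psi> t z - grad_inner (\<phi> t) (\<psi> t) (velocity \<phi> t) z"

subsection \<open>Curvature\<close>

text \<open>\<open>D\<^sub>t D\<^sub>s \<psi> - D\<^sub>s D\<^sub>t \<psi>\<close> for a field \<open>\<psi>\<close> along a two-parameter family \<open>\<phi>\<close>.\<close>

definition cov_commutator ::
    "(real \<Rightarrow> real \<Rightarrow> complex^'n \<Rightarrow> real) \<Rightarrow> (real \<Rightarrow> real \<Rightarrow> complex^'n \<Rightarrow> real) \<Rightarrow>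
     real \<Rightarrow> real \<Rightarrow> complex^'n \<Rightarrow> real" where
  "cov_commutator \<phi> \<psi> t s z =
     cov_deriv (\<lambda>\<tau>. \<phi> \<tau> s) (\<lambda>\<tau>. cov_deriv (\<phi> \<tau>) (\<psi> \<tau>) s) t z
   - cov_deriv (\<phi> t) (\<lambda>\<sigma>. cov_deriv (\<lambda>\<tau>. \<phi> \<tau> \<sigma>) (\<lambda>\<tau>. \<psi> \<tau> \<sigma>) t) s z"

text \<open>
  \<open>R\<^sub>\<phi>(\<xi>, \<eta>)\<zeta>\<close>, computed along the affine family \<open>\<phi> + t \<xi> + s \<eta>\<close> and the constant
  extension of \<open>\<zeta>\<close>.
\<close>

definition mabuchi_curvature ::
    "(complex^'n \<Rightarrow> real) \<Rightarrow> (complex^'n \<Rightarrow> real) \<Rightarrow> (complex^'n \<Rightarrow> real) \<Rightarrow> (complex^'n \<Rightarrow> real) \<Rightarrow>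
     complex^'n \<Rightarrow> real" where
  "mabuchi_curvature \<phi> \<xi> \<eta> \<zeta> =
     cov_commutator (\<lambda>t s z. \<phi> z + t * \<xi> z + s * \<eta> z) (\<lambda>t s. \<zeta>) 0 0"

text \<open>
  \<open>R\<close> is the curvature tensor of \<open>D\<close>: it gives the commutator along \<^emph>\<open>every\<close> two-parameter
  family.  Families in the Mabuchi space and fields in its tangent spaces are included; the
  boundary condition is dropped so that \<open>R\<close> is also pinned down on covariant derivatives.
\<close>

definition is_curvature_tensor ::
    "(complex^'n) set \<Rightarrow>
     ((complex^'n \<Rightarrow> real) \<Rightarrow> (complex^'n \<Rightarrow> real) \<Rightarrow> (complex^'n \<Rightarrow> real) \<Rightarrow> (complex^'n \<Rightarrow> real) \<Rightarrow>
      complex^'n \<Rightarrow> real) \<Rightarrow> bool" where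
  "is_curvature_tensor \<Omega> R \<longleftrightarrow>
     (\<forall>P \<phi> \<psi>. open P \<and>
        smooth_family P \<Omega> (\<lambda>(t, s). \<phi> t s) \<and> smooth_family P \<Omega> (\<lambda>(t, s). \<psi> t s) \<and>
        (\<forall>(t, s)\<in>P. \<phi> t s \<in> strictly_psh \<Omega>) \<longrightarrow>
        (\<forall>(t, s)\<in>P. \<forall>z\<in>closure \<Omega>.
           R (\<phi> t s) (velocity (\<lambda>\<tau>. \<phi> \<tau> s) t) (velocity (\<phi> t) s) (\<psi> t s) z
             = cov_commutator \<phi> \<psi> t s z))"

text \<open>\<open>(D\<^sub>r R\<^sub>\<phi>)(\<phi>\<^sub>t, \<phi>\<^sub>s)\<psi>\<close> for a three-parameter family.\<close>

definition cov_deriv_curvature ::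
    "((complex^'n \<Rightarrow> real) \<Rightarrow> (complex^'n \<Rightarrow> real) \<Rightarrow> (complex^'n \<Rightarrow> real) \<Rightarrow> (complex^'n \<Rightarrow> real) \<Rightarrow>
      complex^'n \<Rightarrow> real) \<Rightarrow>
     (real \<Rightarrow> real \<Rightarrow> real \<Rightarrow> complex^'n \<Rightarrow> real) \<Rightarrow> (real \<Rightarrow> real \<Rightarrow> real \<Rightarrow> complex^'n \<Rightarrow> real) \<Rightarrow>
     real \<Rightarrow> real \<Rightarrow> real \<Rightarrow> complex^'n \<Rightarrow> real" where
  "cov_deriv_curvature R \<phi> \<psi> t s r z =
     (let \<phi>t = (\<lambda>\<rho>. velocity (\<lambda>\<tau>. \<phi> \<tau> s \<rho>) t);
          \<phi>s = (\<lambda>\<rho>. velocity (\<lambda>\<sigma>. \<phi> t \<sigma> \<rho>) s);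
          Dr = (\<lambda>\<theta>. cov_deriv (\<phi> t s) \<theta> r)
      in Dr (\<lambda>\<rho>. R (\<phi> t s \<rho>) (\<phi>t \<rho>) (\<phi>s \<rho>) (\<psi> t s \<rho>)) z
         - R (\<phi> t s r) (Dr \<phi>t) (\<phi>s r) (\<psi> t s r) z
         - R (\<phi> t s r) (\<phi>t r) (Dr \<phi>s) (\<psi> t s r) z
         - R (\<phi> t s r) (\<phi>t r) (\<phi>s r) (Dr (\<psi> t s)) z)"

definition parallel_curvature ::
    "(complex^'n) set \<Rightarrow>
     ((complex^'n \<Rightarrow> real) \<Rightarrow> (complex^'n \<Rightarrow> real) \<Rightarrow> (complex^'n \<Rightarrow> real) \<Rightarrow> (complex^'n \<Rightarrow> real) \<Rightarrow>
      complex^'n \<Rightarrow> real) \<Rightarrow> bool" where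
  "parallel_curvature \<Omega> R \<longleftrightarrow>
     (\<forall>P \<phi> \<psi>. open P \<and>
        smooth_family P \<Omega> (\<lambda>(t, s, r). \<phi> t s r) \<and> smooth_family P \<Omega> (\<lambda>(t, s, r). \<psi> t s r) \<and>
        (\<forall>(t, s, r)\<in>P. \<phi> t s r \<in> mabuchi_space \<Omega> \<and> \<psi> t s r \<in> mabuchi_tangent \<Omega>) \<longrightarrow>
        (\<forall>(t, s, r)\<in>P. \<forall>z\<in>closure \<Omega>. cov_deriv_curvature R \<phi> \<psi> t s r z = 0))"

end

theory Submission
  imports Defs
begin

text \<open>
  A family \<open>\<phi>\<close> is one function \<open>\<Phi>\<close> on the product of parameter space and \<open>\<complex>\<^sup>n\<close>.  On the product
  consider the closed two-form \<open>\<omega> = d(d\<^sup>c \<Phi>)\<close>, with \<open>d\<close> in all variables and \<open>d\<^sup>c\<close> only along the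
  fibres.  Since the contraction of \<open>\<omega>\<close> by \<open>\<nabla>g\<close> is \<open>d\<^sup>c g\<close> on the fibres, the covariant derivative
  \<open>D\<^sub>t\<close> is the derivative along the field \<open>T = \<partial>\<^sub>t - \<nabla>\<phi>\<^sub>t\<close>, the lift of \<open>\<partial>\<^sub>t\<close> that is
  \<open>\<omega>\<close>-orthogonal to the fibres.  As \<open>\<omega>\<close> is closed, the vertical field \<open>[T, S]\<close> is Hamiltonian
  with Hamiltonian \<open>\<omega>(T, S)\<close>, which is a multiple of the Poisson bracket of \<open>\<phi>\<^sub>t\<close> and \<open>\<phi>\<^sub>s\<close>;
  thus \<open>R(\<phi>\<^sub>t, \<phi>\<^sub>s)\<psi>\<close> is a multiple of \<open>{{\<phi>\<^sub>t, \<phi>\<^sub>s}, \<psi>}\<close>.  Horizontal lifts preserve \<open>\<omega>\<close> along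
  the fibres, so \<open>D\<close> is a derivation of the Poisson bracket, and \<open>DR = 0\<close>.
\<close>

subsection \<open>Calculus of smooth functions\<close>

definition dderiv :: "'a::real_normed_vector \<Rightarrow> ('a \<Rightarrow> real) \<Rightarrow> 'a \<Rightarrow> real" where
  "dderiv v f = (\<lambda>x. frechet_derivative f (at x) v)"

lemma dderiv_eq: "(f has_derivative f') (at x) \<Longrightarrow> dderiv v f x = f' v"
  using frechet_derivative_at[of f f' x] by (simp add: dderiv_def)

lemma has_derivative_dderiv:
  "f differentiable (at x) \<Longrightarrow> (f has_derivative (\<lambda>v. dderiv v f x)) (at x)"
  using frechet_derivative_works by (force simp: dderiv_def)

text \<open>\<open>frechet_derivative\<close> is a choice among the derivatives at the point, and
  both functions have the same ones there; so the choice agrees even where neither is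
  differentiable.\<close>

lemma frechet_derivative_cong_open:
  assumes "open S" "x \<in> S" "\<And>y. y \<in> S \<Longrightarrow> f y = g y"
  shows "frechet_derivative f (at x) = frechet_derivative g (at x)"
proof -
  have "(f has_derivative D) (at x) = (g has_derivative D) (at x)" for D
    using assms has_derivative_transform_within_open[of f D x UNIV S g]
      has_derivative_transform_within_open[of g D x UNIV S f] by auto
  then show ?thesis by (simp add: frechet_derivative_def)
qed

lemma dderiv_cong_open:
  assumes "open S" "x \<in> S" "\<And>y. y \<in> S \<Longrightarrow> f y = g y"
  shows "dderiv v f x = dderiv v g x"
  using frechet_derivative_cong_open[OF assms] by (simp add: dderiv_def)

lemma linear_dderiv: "f differentiable (at x) \<Longrightarrow> linear (\<lambda>v. dderiv v f x)"
  by (simp add: dderiv_def linear_frechet_derivative)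

lemma Ck_on_Suc_dderiv:
  "Ck_on (Suc k) f S \<longleftrightarrow> (\<forall>x\<in>S. f differentiable (at x)) \<and> (\<forall>v. Ck_on k (dderiv v f) S)"
  by (simp add: dderiv_def)

declare Ck_on.simps(2) [simp del] Ck_on_Suc_dderiv [simp]

lemma Ck_on_cong:
  assumes "open S" "\<And>x. x \<in> S \<Longrightarrow> f x = g x" "Ck_on k f S"
  shows "Ck_on k g S"
  using assms(2,3)
proof (induction k arbitrary: f g)
  case 0
  then show ?case using continuous_on_cong[of S S f g] by simp
next
  case (Suc k)
  have "g differentiable (at x)" if "x \<in> S" for x
  proof -
    have "(f has_derivative frechet_derivative f (at x)) (at x)"
      using Suc.prems(2) that frechet_derivative_works by auto
    from has_derivative_transform_within_open[OF this assms(1) that Suc.prems(1)]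
    show ?thesis unfolding differentiable_def by blast
  qed
  moreover have "Ck_on k (dderiv v g) S" for v
  proof (rule Suc.IH[of "dderiv v f"])
    show "Ck_on k (dderiv v f) S" using Suc.prems(2) by simp
  qed (use dderiv_cong_open[OF assms(1)] Suc.prems(1) in blast)
  ultimately show ?case by (simp add: Ck_on_Suc_dderiv)
qed

lemma Ck_on_Suc_imp: "Ck_on (Suc k) f S \<Longrightarrow> Ck_on k f S"
proof (induction k arbitrary: f)
  case 0
  then have "f differentiable_on S"
    by (auto simp: differentiable_on_def intro: differentiable_at_withinI)
  then show ?case by (simp add: differentiable_imp_continuous_on)
next
  case (Suc k)
  then show ?case unfolding Ck_on_Suc_dderiv by simp
qed

lemma Ck_on_subset: "Ck_on k f S \<Longrightarrow> T \<subseteq> S \<Longrightarrow> Ck_on k f T"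
  by (induction k arbitrary: f) (auto intro: continuous_on_subset)

lemma Ck_on_const: "Ck_on k (\<lambda>x. c) S"
  by (induction k arbitrary: c) (auto simp: dderiv_def)

lemma Ck_on_add:
  assumes "open S" "Ck_on k f S" "Ck_on k g S"
  shows "Ck_on k (\<lambda>x. f x + g x) S"
  using assms(2,3)
proof (induction k arbitrary: f g)
  case 0
  then show ?case by (simp add: continuous_on_add)
next
  case (Suc k)
  have eq: "dderiv v (\<lambda>x. f x + g x) x = dderiv v f x + dderiv v g x" if "x \<in> S" for v x
    by (rule dderiv_eq)
      (use Suc.prems that in \<open>auto intro!: derivative_eq_intros has_derivative_dderiv\<close>)
  have "Ck_on k (\<lambda>x. dderiv v f x + dderiv v g x) S" for v
    using Suc by (simp add: Ck_on_Suc_dderiv)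
  then have "Ck_on k (dderiv v (\<lambda>x. f x + g x)) S" for v
    using Ck_on_cong[OF assms(1)] eq by simp
  then show ?case using Suc.prems by (simp add: Ck_on_Suc_dderiv)
qed

lemma Ck_on_mult:
  assumes "open S" "Ck_on k f S" "Ck_on k g S"
  shows "Ck_on k (\<lambda>x. f x * g x) S"
  using assms(2,3)
proof (induction k arbitrary: f g)
  case 0
  then show ?case by (simp add: continuous_on_mult)
next
  case (Suc k)
  have eq: "dderiv v (\<lambda>x. f x * g x) x = f x * dderiv v g x + dderiv v f x * g x"
    if "x \<in> S" for v x
    by (rule dderiv_eq)
      (use Suc.prems that in \<open>auto intro!: derivative_eq_intros has_derivative_dderiv\<close>)
  have "Ck_on k (\<lambda>x. f x * dderiv v g x + dderiv v f x * g x) S" for v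
    using Suc Suc.prems[THEN Ck_on_Suc_imp]
    by (intro Ck_on_add assms(1)) (simp_all add: Ck_on_Suc_dderiv)
  then have "Ck_on k (dderiv v (\<lambda>x. f x * g x)) S" for v
    using Ck_on_cong[OF assms(1)] eq by simp
  then show ?case using Suc.prems by (simp add: Ck_on_Suc_dderiv)
qed

text \<open>The derivative contains \<open>inverse (f x)\<close> again, which the induction
  hypothesis covers at order \<open>k\<close>.\<close>

lemma Ck_on_inverse:
  assumes "open S" "Ck_on k f S" "\<And>x. x \<in> S \<Longrightarrow> f x \<noteq> 0"
  shows "Ck_on k (\<lambda>x. inverse (f x)) S"
  using assms(2)
proof (induction k)
  case 0
  then show ?case using assms(3) by (simp add: continuous_on_inverse)
next
  case (Suc k)
  have eq: "dderiv v (\<lambda>x. inverse (f x)) x = inverse (f x) * (inverse (f x) * (- 1 * dderiv v f x))"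
    if "x \<in> S" for v x
    by (rule dderiv_eq)
      (use Suc.prems assms(3) that in
        \<open>auto intro!: derivative_eq_intros has_derivative_dderiv simp: algebra_simps\<close>)
  have "Ck_on k (\<lambda>x. inverse (f x) * (inverse (f x) * (- 1 * dderiv v f x))) S" for v
    using Suc Suc.prems[THEN Ck_on_Suc_imp]
    by (intro Ck_on_mult Ck_on_const assms(1)) (simp_all add: Ck_on_Suc_dderiv)
  then have "Ck_on k (dderiv v (\<lambda>x. inverse (f x))) S" for v
    using Ck_on_cong[OF assms(1)] eq by simp
  moreover have "(\<lambda>x. inverse (f x)) differentiable (at x)" if "x \<in> S" for x
    using Suc.prems assms(3) that by auto
  ultimately show ?case by (simp add: Ck_on_Suc_dderiv)
qed

text \<open>Differentiating in direction \<open>v\<close> gives the same kind of composite with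
  \<open>dderiv (L v) f\<close>, so the induction runs over all \<open>f\<close>. This serves slices
  and projections of products.\<close>

lemma Ck_on_compose_affine:
  fixes L :: "'a::euclidean_space \<Rightarrow> 'b::euclidean_space"
  assumes "bounded_linear L" "Ck_on k f S" "open T" "\<And>x. x \<in> T \<Longrightarrow> L x + c \<in> S"
  shows "Ck_on k (\<lambda>x. f (L x + c)) T"
  using assms(2)
proof (induction k arbitrary: f)
  case 0
  have "continuous_on T (\<lambda>x. L x + c)"
    by (intro continuous_on_add continuous_on_const linear_continuous_on assms(1))
  with 0 show ?case using assms(4) by (auto intro: continuous_on_compose2[of S f])
next
  case (Suc k)
  have der: "((\<lambda>x. f (L x + c)) has_derivative (\<lambda>v. dderiv (L v) f (L x + c))) (at x)"
    if "x \<in> T" for x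
  proof -
    have "(f has_derivative (\<lambda>v. dderiv v f (L x + c))) (at (L x + c))"
      using Suc.prems that assms(4) by (auto intro!: has_derivative_dderiv)
    moreover have "((\<lambda>x. L x + c) has_derivative L) (at x)"
      using assms(1) by (auto intro!: derivative_eq_intros bounded_linear_imp_has_derivative)
    ultimately show ?thesis by (rule has_derivative_compose[rotated])
  qed
  have "Ck_on k (\<lambda>x. dderiv (L v) f (L x + c)) T" for v
    using Suc by (simp add: Ck_on_Suc_dderiv)
  then have "Ck_on k (dderiv v (\<lambda>x. f (L x + c))) T" for v
    using Ck_on_cong[OF assms(3)] dderiv_eq[OF der] by simp
  moreover have "(\<lambda>x. f (L x + c)) differentiable (at x)" if "x \<in> T" for x
    using der[OF that] unfolding differentiable_def by blast
  ultimately show ?case by simp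
qed

lemma smooth_on_iff:
  "smooth_on f S \<longleftrightarrow> (\<forall>x\<in>S. f differentiable (at x)) \<and> (\<forall>v. smooth_on (dderiv v f) S)"
  (is "?l = ?r")
proof
  show "?l \<Longrightarrow> ?r" unfolding smooth_on_def using Ck_on_Suc_dderiv by blast
  assume r: ?r
  show ?l unfolding smooth_on_def
  proof
    fix k
    have "Ck_on (Suc k) f S" using r by (simp add: smooth_on_def Ck_on_Suc_dderiv)
    then show "Ck_on k f S" by (rule Ck_on_Suc_imp)
  qed
qed

lemma smooth_on_differentiable: "smooth_on f S \<Longrightarrow> x \<in> S \<Longrightarrow> f differentiable (at x)"
  using smooth_on_iff by blast

lemma smooth_on_dderiv: "smooth_on f S \<Longrightarrow> smooth_on (dderiv v f) S"
  using smooth_on_iff by blast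

lemma smooth_on_has_derivative:
  "smooth_on f S \<Longrightarrow> x \<in> S \<Longrightarrow> (f has_derivative (\<lambda>v. dderiv v f x)) (at x)"
  by (simp add: has_derivative_dderiv smooth_on_differentiable)

lemma smooth_on_continuous: "smooth_on f S \<Longrightarrow> continuous_on S f"
  unfolding smooth_on_def using Ck_on.simps(1) by blast

lemma smooth_on_cong: "open S \<Longrightarrow> (\<And>x. x \<in> S \<Longrightarrow> f x = g x) \<Longrightarrow> smooth_on f S \<Longrightarrow> smooth_on g S"
  unfolding smooth_on_def using Ck_on_cong by blast

lemma smooth_on_subset: "smooth_on f S \<Longrightarrow> T \<subseteq> S \<Longrightarrow> smooth_on f T"
  unfolding smooth_on_def using Ck_on_subset by blast

lemma smooth_on_const: "smooth_on (\<lambda>x. c) S"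
  by (simp add: smooth_on_def Ck_on_const)

lemma smooth_on_add:
  "open S \<Longrightarrow> smooth_on f S \<Longrightarrow> smooth_on g S \<Longrightarrow> smooth_on (\<lambda>x. f x + g x) S"
  by (simp add: smooth_on_def Ck_on_add)

lemma smooth_on_mult:
  "open S \<Longrightarrow> smooth_on f S \<Longrightarrow> smooth_on g S \<Longrightarrow> smooth_on (\<lambda>x. f x * g x) S"
  by (simp add: smooth_on_def Ck_on_mult)

lemma smooth_on_minus: "open S \<Longrightarrow> smooth_on f S \<Longrightarrow> smooth_on (\<lambda>x. - f x) S"
  using smooth_on_mult[OF _ smooth_on_const[of "- 1"], of S f] by simp

lemma smooth_on_diff:
  "open S \<Longrightarrow> smooth_on f S \<Longrightarrow> smooth_on g S \<Longrightarrow> smooth_on (\<lambda>x. f x - g x) S"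
  using smooth_on_add[of S f "\<lambda>x. - g x"] by (simp add: smooth_on_minus)

lemma smooth_on_sum:
  "open S \<Longrightarrow> (\<And>i. i \<in> I \<Longrightarrow> smooth_on (f i) S) \<Longrightarrow> smooth_on (\<lambda>x. \<Sum>i\<in>I. f i x) S"
  by (induction I rule: infinite_finite_induct) (auto simp: smooth_on_const smooth_on_add)

lemma smooth_on_prod:
  "open S \<Longrightarrow> (\<And>i. i \<in> I \<Longrightarrow> smooth_on (f i) S) \<Longrightarrow> smooth_on (\<lambda>x. \<Prod>i\<in>I. f i x) S"
  by (induction I rule: infinite_finite_induct) (auto simp: smooth_on_const smooth_on_mult)

lemma smooth_on_divide:
  "open S \<Longrightarrow> smooth_on f S \<Longrightarrow> smooth_on g S \<Longrightarrow> (\<And>x. x \<in> S \<Longrightarrow> g x \<noteq> 0) \<Longrightarrow>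
    smooth_on (\<lambda>x. f x / g x) S"
  using Ck_on_inverse[of S _ g] smooth_on_mult[of S f "\<lambda>x. inverse (g x)"]
  by (simp add: smooth_on_def divide_inverse)

lemma smooth_on_compose_affine:
  fixes L :: "'a::euclidean_space \<Rightarrow> 'b::euclidean_space"
  assumes "bounded_linear L" "smooth_on f S" "open T" "\<And>x. x \<in> T \<Longrightarrow> L x + c \<in> S"
  shows "smooth_on (\<lambda>x. f (L x + c)) T"
  using assms Ck_on_compose_affine unfolding smooth_on_def by blast

lemma smooth_on_linear:
  assumes "bounded_linear (L :: 'a::euclidean_space \<Rightarrow> real)"
  shows "smooth_on L S"
proof -
  have "(L has_derivative L) (at x)" for x
    using assms by (rule bounded_linear_imp_has_derivative)
  then have "dderiv v L = (\<lambda>x. L v)" "L differentiable (at x)" for v x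
    by (auto simp: dderiv_eq fun_eq_iff differentiable_def)
  then show ?thesis by (subst smooth_on_iff) (auto simp: smooth_on_const)
qed

lemma smooth_on_det:
  fixes A :: "'a::euclidean_space \<Rightarrow> real^'m^'m"
  assumes "open S" "\<And>i j. smooth_on (\<lambda>x. A x $ i $ j) S"
  shows "smooth_on (\<lambda>x. det (A x)) S"
  unfolding det_def
  by (intro smooth_on_sum smooth_on_mult smooth_on_prod smooth_on_const assms)

text \<open>The second difference of \<open>f\<close> over a small parallelogram, divided by its size, is a value of
  \<open>\<partial>\<^sub>u\<partial>\<^sub>v f\<close> at a nearby point by two applications of the mean value theorem.\<close>

lemma second_difference_mvt:
  fixes f :: "'a::euclidean_space \<Rightarrow> real"
  assumes f: "smooth_on f S" and h: "0 < h"
    and seg: "\<And>s t. 0 \<le> s \<Longrightarrow> s \<le> h \<Longrightarrow> 0 \<le> t \<Longrightarrow> t \<le> h \<Longrightarrow> x + s *\<^sub>R u + t *\<^sub>R v \<in> S"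
  obtains s t where "0 < s" "s < h" "0 < t" "t < h"
    "f (x + h *\<^sub>R u + h *\<^sub>R v) - f (x + h *\<^sub>R u) - (f (x + h *\<^sub>R v) - f x)
      = h * h * dderiv v (dderiv u f) (x + s *\<^sub>R u + t *\<^sub>R v)"
proof -
  have der: "((\<lambda>a. g (y + a *\<^sub>R w)) has_derivative (\<lambda>b. b * dderiv w g (y + a *\<^sub>R w))) (at a)"
    if "smooth_on g S" "y + a *\<^sub>R w \<in> S" for g y a w
  proof -
    have "((\<lambda>a. g (y + a *\<^sub>R w)) has_derivative (\<lambda>b. dderiv (b *\<^sub>R w) g (y + a *\<^sub>R w))) (at a)"
      by (rule has_derivative_compose[of "\<lambda>a. y + a *\<^sub>R w" "\<lambda>b. b *\<^sub>R w" a UNIV g,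
          OF _ smooth_on_has_derivative[OF that]])
        (auto intro!: derivative_eq_intros)
    then show ?thesis
      by (simp add: linear_scale[OF linear_dderiv[OF smooth_on_differentiable[OF that]]])
  qed
  let ?F = "\<lambda>s. f ((x + h *\<^sub>R v) + s *\<^sub>R u) - f (x + s *\<^sub>R u)"
  have F: "(?F has_derivative (\<lambda>b. b * dderiv u f ((x + h *\<^sub>R v) + s *\<^sub>R u) - b * dderiv u f (x + s *\<^sub>R u)))
      (at s)" if "0 \<le> s" "s \<le> h" for s
    using seg[of s h] seg[of s 0] that h
    by (intro has_derivative_diff der f) (simp_all add: algebra_simps)
  obtain s where s: "0 < s" "s < h"
    "?F h - ?F 0 = h * dderiv u f ((x + h *\<^sub>R v) + s *\<^sub>R u) - h * dderiv u f (x + s *\<^sub>R u)"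
    using mvt_simple[OF h has_derivative_at_withinI[OF F]] by fastforce
  let ?G = "\<lambda>t. dderiv u f ((x + s *\<^sub>R u) + t *\<^sub>R v)"
  have G: "(?G has_derivative (\<lambda>b. b * dderiv v (dderiv u f) ((x + s *\<^sub>R u) + t *\<^sub>R v))) (at t)"
    if "0 \<le> t" "t \<le> h" for t
    using seg[of s t] s that by (intro der smooth_on_dderiv f) simp
  obtain t where t: "0 < t" "t < h"
    "?G h - ?G 0 = h * dderiv v (dderiv u f) ((x + s *\<^sub>R u) + t *\<^sub>R v)"
    using mvt_simple[OF h has_derivative_at_withinI[OF G]] by fastforce
  have "?F h - ?F 0 = h * (?G h - ?G 0)"
    using s(3) by (simp add: algebra_simps)
  then show ?thesis
    using that[OF s(1,2) t(1,2)] t(3) by (simp add: algebra_simps)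
qed

text \<open>The second difference is symmetric in \<open>u\<close> and \<open>v\<close>, so
  \<open>second_difference_mvt\<close> yields two points near \<open>x\<close> at which the one
  mixed derivative equals the other; continuity at \<open>x\<close> does the rest.\<close>

lemma dderiv_commute:
  fixes f :: "'a::euclidean_space \<Rightarrow> real"
  assumes S: "open S" and f: "smooth_on f S" and x: "x \<in> S"
  shows "dderiv u (dderiv v f) x = dderiv v (dderiv u f) x"
proof (rule ccontr)
  let ?A = "dderiv v (dderiv u f)" and ?B = "dderiv u (dderiv v f)"
  assume ne: "?B x \<noteq> ?A x"
  \<comment> \<open>Half the gap: values within \<open>e\<close> of \<open>?A x\<close> and of
    \<open>?B x\<close> cannot coincide.\<close>
  define e where "e = \<bar>?B x - ?A x\<bar> / 2"
  have e: "0 < e" using ne by (simp add: e_def)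
  have cont: "isCont ?A x" "isCont ?B x"
    using smooth_on_continuous[OF smooth_on_dderiv[OF smooth_on_dderiv[OF f]]] S x
      continuous_on_eq_continuous_at by blast+
  obtain d1 where d1: "0 < d1" "\<And>y. dist y x < d1 \<Longrightarrow> \<bar>?A y - ?A x\<bar> < e"
    using cont(1) e unfolding continuous_at_eps_delta by (auto simp: dist_real_def dist_commute)
  obtain d2 where d2: "0 < d2" "\<And>y. dist y x < d2 \<Longrightarrow> \<bar>?B y - ?B x\<bar> < e"
    using cont(2) e unfolding continuous_at_eps_delta by (auto simp: dist_real_def dist_commute)
  obtain d3 where d3: "0 < d3" "\<And>y. dist y x < d3 \<Longrightarrow> y \<in> S"
    using S x unfolding open_dist by blast
  define d where "d = min d1 (min d2 d3)"
  \<comment> \<open>Small enough to keep the whole parallelogram within \<open>d\<close> of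
    \<open>x\<close>; the summand 1 keeps the denominator positive when \<open>u\<close> and
    \<open>v\<close> vanish.\<close>
  define h where "h = d / (2 * (norm u + norm v + 1))"
  have pos: "0 < norm u + norm v + 1" using norm_ge_zero[of u] norm_ge_zero[of v] by linarith
  have d: "0 < d" and h: "0 < h" using d1 d2 d3 pos by (auto simp: d_def h_def)
  have hd: "h * (norm u + norm v) < d"
  proof -
    have "h * (norm u + norm v + 1) = d / 2" using pos by (simp add: h_def field_simps)
    then show ?thesis using d h by (simp add: algebra_simps)
  qed
  have near: "dist (x + s *\<^sub>R u + t *\<^sub>R v) x < d" if "0 \<le> s" "s \<le> h" "0 \<le> t" "t \<le> h" for s t
  proof -
    have "dist (x + s *\<^sub>R u + t *\<^sub>R v) x = norm (s *\<^sub>R u + t *\<^sub>R v)"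
      by (simp add: dist_norm add.assoc)
    also have "\<dots> \<le> s * norm u + t * norm v"
      using that norm_triangle_ineq[of "s *\<^sub>R u" "t *\<^sub>R v"] by simp
    also have "\<dots> \<le> h * norm u + h * norm v"
      using that by (intro add_mono mult_right_mono) auto
    finally show ?thesis using hd by (simp add: algebra_simps)
  qed
  have inS: "x + s *\<^sub>R u + t *\<^sub>R v \<in> S" if "0 \<le> s" "s \<le> h" "0 \<le> t" "t \<le> h" for s t
    using near[OF that] d3(2) by (simp add: d_def)
  obtain s t where 1: "0 < s" "s < h" "0 < t" "t < h"
    "f (x + h *\<^sub>R u + h *\<^sub>R v) - f (x + h *\<^sub>R u) - (f (x + h *\<^sub>R v) - f x)
      = h * h * ?A (x + s *\<^sub>R u + t *\<^sub>R v)"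
    by (rule second_difference_mvt[OF f h, of x u v]) (use inS in auto)
  obtain s' t' where 2: "0 < s'" "s' < h" "0 < t'" "t' < h"
    "f (x + h *\<^sub>R v + h *\<^sub>R u) - f (x + h *\<^sub>R v) - (f (x + h *\<^sub>R u) - f x)
      = h * h * ?B (x + s' *\<^sub>R v + t' *\<^sub>R u)"
    by (rule second_difference_mvt[OF f h, of x v u])
      (use inS in \<open>auto simp: add.assoc add.commute[of "_ *\<^sub>R v"]\<close>)
  have "h * h * ?A (x + s *\<^sub>R u + t *\<^sub>R v) = h * h * ?B (x + s' *\<^sub>R v + t' *\<^sub>R u)"
    unfolding 1(5)[symmetric] 2(5)[symmetric] by (simp add: algebra_simps)
  then have "?A (x + s *\<^sub>R u + t *\<^sub>R v) = ?B (x + t' *\<^sub>R u + s' *\<^sub>R v)"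
    using h by (simp add: algebra_simps)
  moreover have "\<bar>?A (x + s *\<^sub>R u + t *\<^sub>R v) - ?A x\<bar> < e"
    using near[of s t] 1 d1 by (simp add: d_def)
  moreover have "\<bar>?B (x + t' *\<^sub>R u + s' *\<^sub>R v) - ?B x\<bar> < e"
    using near[of t' s'] 2 d2 by (simp add: d_def)
  ultimately show False unfolding e_def by (smt (verit) field_sum_of_halves)
qed

subsection \<open>Smooth fields\<close>

text \<open>A finite sum of products reduces variable functionals applied to variable vectors to the
  scalar sum and product rules.\<close>

lemma pairing_expand:
  fixes L :: "'b::euclidean_space \<Rightarrow> real"
  assumes "linear L"
  shows "L a = (\<Sum>b\<in>Basis. (a \<bullet> b) * L b)"
  using linear_sum[OF assms, of "\<lambda>b. (a \<bullet> b) *\<^sub>R b" Basis]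
  by (simp add: euclidean_representation linear_scale[OF assms])

lemma has_derivative_pairing:
  fixes L :: "'a::euclidean_space \<Rightarrow> 'b::euclidean_space \<Rightarrow> real"
  assumes W: "open W" "x \<in> W" and lin: "\<And>y. y \<in> W \<Longrightarrow> linear (L y)"
    and L: "\<And>a. (\<lambda>y. L y a) differentiable (at x)" and X: "(X has_derivative X') (at x)"
  shows "((\<lambda>y. L y (X y)) has_derivative (\<lambda>u. dderiv u (\<lambda>y. L y (X x)) x + L x (X' u))) (at x)"
proof -
  have *: "((\<lambda>y. \<Sum>b\<in>Basis. (Z y \<bullet> b) * L y b) has_derivative
      (\<lambda>u. (\<Sum>b\<in>Basis. (Z x \<bullet> b) * dderiv u (\<lambda>y. L y b) x) + L x (Z' u))) (at x)"
    if "(Z has_derivative Z') (at x)" for Z Z'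
  proof -
    have "((\<lambda>y. \<Sum>b\<in>Basis. (Z y \<bullet> b) * L y b) has_derivative
        (\<lambda>u. \<Sum>b\<in>Basis. (Z x \<bullet> b) * dderiv u (\<lambda>y. L y b) x + (Z' u \<bullet> b) * L x b)) (at x)"
      by (intro has_derivative_sum has_derivative_mult has_derivative_inner_left that
          has_derivative_dderiv L)
    moreover have "(\<Sum>b\<in>Basis. (Z' u \<bullet> b) * L x b) = L x (Z' u)" for u
      using pairing_expand[OF lin[OF W(2)], of "Z' u"] by (rule sym)
    ultimately show ?thesis by (simp only: sum.distrib)
  qed
  have **: "((\<lambda>y. L y (Z y)) has_derivative
      (\<lambda>u. (\<Sum>b\<in>Basis. (Z x \<bullet> b) * dderiv u (\<lambda>y. L y b) x) + L x (Z' u))) (at x)"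
    if "(Z has_derivative Z') (at x)" for Z Z'
    by (rule has_derivative_transform_within_open[OF *[OF that] W])
      (rule pairing_expand[OF lin, symmetric])
  \<comment> \<open>The same formula for the constant field \<open>X x\<close> identifies the sum as
    the derivative with the vector frozen at \<open>x\<close>.\<close>
  have "dderiv u (\<lambda>y. L y (X x)) x = (\<Sum>b\<in>Basis. (X x \<bullet> b) * dderiv u (\<lambda>y. L y b) x)" for u
    using dderiv_eq[OF **[OF has_derivative_const[of "X x"]], of u]
    by (simp only: linear_0[OF lin[OF W(2)]] add_0_right)
  then show ?thesis using **[OF X] by (simp only:)
qed

lemma has_derivative_bilinear_pairing:
  fixes B :: "'a::euclidean_space \<Rightarrow> 'b::euclidean_space \<Rightarrow> 'c::euclidean_space \<Rightarrow> real"
  assumes W: "open W" "x \<in> W" and bil: "\<And>y. y \<in> W \<Longrightarrow> bilinear (B y)"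
    and B: "\<And>a b. (\<lambda>y. B y a b) differentiable (at x)"
    and X: "(X has_derivative X') (at x)" and Y: "(Y has_derivative Y') (at x)"
  shows "((\<lambda>y. B y (X y) (Y y)) has_derivative
    (\<lambda>u. dderiv u (\<lambda>y. B y (X x) (Y x)) x + B x (X' u) (Y x) + B x (X x) (Y' u))) (at x)"
proof -
  have 1: "((\<lambda>y. B y a (Y y)) has_derivative
      (\<lambda>u. dderiv u (\<lambda>y. B y a (Y x)) x + B x a (Y' u))) (at x)" for a
    using bil by (intro has_derivative_pairing[OF W] B Y) (simp add: bilinear_def)
  have 2: "(\<lambda>y. B y a (Y y)) differentiable (at x)" for a
    using 1 unfolding differentiable_def by blast
  have "((\<lambda>y. B y (X y) (Y y)) has_derivative
      (\<lambda>u. dderiv u (\<lambda>y. B y (X x) (Y y)) x + B x (X' u) (Y x))) (at x)"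
    using bil 2
    by (intro has_derivative_pairing[OF W, where L = "\<lambda>y a. B y a (Y y)"] X)
      (auto simp: bilinear_def)
  then show ?thesis unfolding dderiv_eq[OF 1] by (simp add: add.commute add.left_commute)
qed

definition smooth_field :: "('a::euclidean_space \<Rightarrow> 'b::euclidean_space) \<Rightarrow> 'a set \<Rightarrow> bool" where
  "smooth_field X S \<longleftrightarrow> (\<forall>b. smooth_on (\<lambda>x. X x \<bullet> b) S)"

lemma smooth_field_has_derivative:
  assumes "smooth_field X S" "x \<in> S"
  shows "(X has_derivative frechet_derivative X (at x)) (at x)"
proof -
  have "X differentiable (at x)"
    using assms smooth_on_differentiable
    by (subst differentiable_componentwise_within) (auto simp: smooth_field_def)
  then show ?thesis using frechet_derivative_works by blast
qed

lemma smooth_on_pairing: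
  fixes L :: "'a::euclidean_space \<Rightarrow> 'b::euclidean_space \<Rightarrow> real"
  assumes W: "open W" and lin: "\<And>y. y \<in> W \<Longrightarrow> linear (L y)"
    and L: "\<And>a. smooth_on (\<lambda>y. L y a) W" and X: "smooth_field X W"
  shows "smooth_on (\<lambda>y. L y (X y)) W"
proof (rule smooth_on_cong[OF W])
  show "smooth_on (\<lambda>y. \<Sum>b\<in>Basis. (X y \<bullet> b) * L y b) W"
    using X L by (intro smooth_on_sum smooth_on_mult W) (auto simp: smooth_field_def)
  show "(\<Sum>b\<in>Basis. (X y \<bullet> b) * L y b) = L y (X y)" if "y \<in> W" for y
    by (rule pairing_expand[OF lin[OF that], symmetric])
qed

lemma linear_dderiv_on: "smooth_on f W \<Longrightarrow> x \<in> W \<Longrightarrow> linear (\<lambda>v. dderiv v f x)"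
  by (rule linear_dderiv[OF smooth_on_differentiable])

lemma smooth_on_dderiv_field:
  assumes "open W" "smooth_on f W" "smooth_field X W"
  shows "smooth_on (\<lambda>y. dderiv (X y) f y) W"
  by (rule smooth_on_pairing[OF assms(1) linear_dderiv_on[OF assms(2)]
        smooth_on_dderiv[OF assms(2)] assms(3)])

text \<open>As second derivatives commute, the first-order term with \<open>X' u\<close> is all that
  survives in a commutator of two fields.\<close>

lemma dderiv_dderiv_field:
  assumes "open W" "x \<in> W" "smooth_on f W" "(X has_derivative X') (at x)"
  shows "dderiv u (\<lambda>y. dderiv (X y) f y) x = dderiv u (dderiv (X x) f) x + dderiv (X' u) f x"
  by (rule dderiv_eq, rule has_derivative_pairing[OF assms(1,2) linear_dderiv_on[OF assms(3)] _ assms(4)])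
    (use smooth_on_differentiable[OF smooth_on_dderiv[OF assms(3)] assms(2)] in simp_all)

subsection \<open>The closed two-form of a potential\<close>

text \<open>Exterior derivative, on constant fields \<open>a\<close> and \<open>b\<close>, of the
  one-form sending \<open>v\<close> to \<open>dderiv (j v) \<Phi>\<close>.\<close>

definition ddj :: "('a::euclidean_space \<Rightarrow> 'a) \<Rightarrow> ('a \<Rightarrow> real) \<Rightarrow> 'a \<Rightarrow> 'a \<Rightarrow> 'a \<Rightarrow> real" where
  "ddj j \<Phi> x a b = dderiv a (dderiv (j b) \<Phi>) x - dderiv b (dderiv (j a) \<Phi>) x"

locale potential =
  fixes W :: "'a::euclidean_space set" and \<Phi> :: "'a \<Rightarrow> real" and j :: "'a \<Rightarrow> 'a"
  assumes open_W: "open W" and smooth_pot: "smooth_on \<Phi> W" and linear_j: "linear j"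
begin

abbreviation "\<omega> \<equiv> ddj j \<Phi>"

lemma bilinear_hessian:
  assumes "x \<in> W"
  shows "bilinear (\<lambda>a b. dderiv a (dderiv b \<Phi>) x)"
proof -
  have "linear (\<lambda>a. dderiv a (dderiv b \<Phi>) x)" for b
    using linear_dderiv_on[OF smooth_on_dderiv[OF smooth_pot] assms] .
  moreover from this have "linear (\<lambda>b. dderiv a (dderiv b \<Phi>) x)" for a
    using dderiv_commute[OF open_W smooth_pot assms, of a] by simp
  ultimately show ?thesis by (simp add: bilinear_def)
qed

lemma bilinear_form: "x \<in> W \<Longrightarrow> bilinear (\<omega> x)"
  using bilinear_hessian[of x] linear_j linear_compose[of j "\<lambda>b. dderiv _ (dderiv b \<Phi>) x"]
  unfolding bilinear_def ddj_def o_def by (auto intro!: linear_compose_sub)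

lemma form_antisym: "\<omega> x a b = - \<omega> x b a"
  by (simp add: ddj_def)

lemma smooth_form: "smooth_on (\<lambda>x. \<omega> x a b) W"
  unfolding ddj_def by (intro smooth_on_diff open_W smooth_on_dderiv smooth_pot)

lemma form_differentiable: "x \<in> W \<Longrightarrow> (\<lambda>x. \<omega> x a b) differentiable (at x)"
  using smooth_form smooth_on_differentiable by blast

lemma dderiv_form:
  assumes "x \<in> W"
  shows "dderiv c (\<lambda>y. \<omega> y a b) x
    = dderiv c (dderiv a (dderiv (j b) \<Phi>)) x - dderiv c (dderiv b (dderiv (j a) \<Phi>)) x"
  unfolding ddj_def
  by (rule dderiv_eq)
    (intro has_derivative_diff smooth_on_has_derivative[OF _ assms] smooth_on_dderiv smooth_pot)

text \<open>The six third derivatives cancel in pairs once the two outer directions are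
  commuted.\<close>

lemma form_closed:
  assumes "x \<in> W"
  shows "dderiv a (\<lambda>y. \<omega> y b c) x + dderiv b (\<lambda>y. \<omega> y c a) x + dderiv c (\<lambda>y. \<omega> y a b) x = 0"
  unfolding dderiv_form[OF assms]
  using dderiv_commute[OF open_W smooth_on_dderiv[OF smooth_pot] assms] by simp

lemma dderiv_form_fields:
  assumes "x \<in> W" "(X has_derivative X') (at x)" "(Y has_derivative Y') (at x)"
  shows "dderiv u (\<lambda>y. \<omega> y (X y) (Y y)) x
    = dderiv u (\<lambda>y. \<omega> y (X x) (Y x)) x + \<omega> x (X' u) (Y x) + \<omega> x (X x) (Y' u)"
  by (rule dderiv_eq, rule has_derivative_bilinear_pairing[OF open_W])
    (use assms bilinear_form form_differentiable in auto)

lemma dderiv_form_field: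
  assumes "x \<in> W" "(X has_derivative X') (at x)"
  shows "dderiv u (\<lambda>y. \<omega> y (X y) b) x = dderiv u (\<lambda>y. \<omega> y (X x) b) x + \<omega> x (X' u) b"
  using dderiv_form_fields[OF assms has_derivative_const, of u b] bilinear_form[OF assms(1)]
  by (simp add: bilinear_rzero)

lemma dderiv_zero_on:
  assumes "x \<in> W" "\<And>y. y \<in> W \<Longrightarrow> f y = 0"
  shows "dderiv u f x = 0"
proof -
  have "dderiv u f x = dderiv u (\<lambda>_. 0) x"
    using assms by (intro dderiv_cong_open[OF open_W]) auto
  then show ?thesis by (simp add: dderiv_def)
qed

lemma form_commutator:
  assumes x: "x \<in> W" and T: "(T has_derivative T') (at x)" and S: "(S has_derivative S') (at x)"
    and horT: "\<And>y v. y \<in> W \<Longrightarrow> v \<in> K \<Longrightarrow> \<omega> y (T y) v = 0"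
    and horS: "\<And>y v. y \<in> W \<Longrightarrow> v \<in> K \<Longrightarrow> \<omega> y (S y) v = 0"
    and T': "\<And>u. T' u \<in> K" and S': "\<And>u. S' u \<in> K" and v: "v \<in> K"
  shows "dderiv v (\<lambda>y. \<omega> y (T y) (S y)) x = \<omega> x (S' (T x) - T' (S x)) v"
proof -
  \<comment> \<open>\<open>T'\<close> and \<open>S'\<close> take values in \<open>K\<close>, so
    horizontality kills the product-rule terms in which a field is differentiated.\<close>
  have "dderiv v (\<lambda>y. \<omega> y (T y) (S y)) x = dderiv v (\<lambda>y. \<omega> y (T x) (S x)) x"
    unfolding dderiv_form_fields[OF x T S]
    using horT[OF x S'] horS[OF x T'] form_antisym[of x "T' v" "S x"] by simp
  moreover have "dderiv (T x) (\<lambda>y. \<omega> y (S x) v) x + \<omega> x (S' (T x)) v = 0"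
    using dderiv_form_field[OF x S, of "T x" v] dderiv_zero_on[OF x horS[OF _ v]] by simp
  moreover have "dderiv (S x) (\<lambda>y. \<omega> y (T x) v) x + \<omega> x (T' (S x)) v = 0"
    using dderiv_form_field[OF x T, of "S x" v] dderiv_zero_on[OF x horT[OF _ v]] by simp
  moreover have "dderiv (S x) (\<lambda>y. \<omega> y v (T x)) x = - dderiv (S x) (\<lambda>y. \<omega> y (T x) v) x"
    by (simp add: dderiv_form[OF x])
  ultimately show ?thesis
    using form_closed[OF x, of "T x" "S x" v] bilinear_form[OF x] by (simp add: bilinear_lsub)
qed

text \<open>A field annihilating \<open>K\<close> preserves the form along \<open>K\<close>, hence its bracket with the
  Hamiltonian field of \<open>f\<close> is the Hamiltonian field of the derivative of \<open>f\<close>.\<close>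

lemma form_hamiltonian_bracket:
  assumes x: "x \<in> W" and f: "smooth_on f W"
    and T: "(T has_derivative T') (at x)"
    and horT: "\<And>y v. y \<in> W \<Longrightarrow> v \<in> K \<Longrightarrow> \<omega> y (T y) v = 0"
    and ham: "\<And>y v. y \<in> W \<Longrightarrow> v \<in> K \<Longrightarrow> \<omega> y (X y) v = c * dderiv v f y"
    and T': "\<And>u. T' u \<in> K" and X: "(X has_derivative X') (at x)" and XK: "X x \<in> K" and v: "v \<in> K"
  shows "\<omega> x (X' (T x) - T' (X x)) v = c * dderiv v (\<lambda>y. dderiv (T y) f y) x"
proof -
  have "dderiv (T x) (\<lambda>y. \<omega> y (X x) v) x + \<omega> x (X' (T x)) v = c * dderiv (T x) (dderiv v f) x"
  proof -
    have "dderiv (T x) (\<lambda>y. \<omega> y (X y) v) x = dderiv (T x) (\<lambda>y. c * dderiv v f y) x"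
      using ham[OF _ v] by (intro dderiv_cong_open[OF open_W x]) auto
    also have "\<dots> = c * dderiv (T x) (dderiv v f) x"
      by (rule dderiv_eq)
        (intro has_derivative_mult_right smooth_on_has_derivative[OF _ x] smooth_on_dderiv f)
    finally show ?thesis using dderiv_form_field[OF x X] by simp
  qed
  moreover have "dderiv (X x) (\<lambda>y. \<omega> y (T x) v) x + \<omega> x (T' (X x)) v = 0"
    using dderiv_form_field[OF x T, of "X x" v] dderiv_zero_on[OF x horT[OF _ v]] by simp
  moreover have "dderiv v (\<lambda>y. \<omega> y (T x) (X x)) x + \<omega> x (T' v) (X x) = 0"
    using dderiv_form_field[OF x T, of v "X x"] dderiv_zero_on[OF x horT[OF _ XK]] by simp
  \<comment> \<open>\<open>T' v\<close> lies in \<open>K\<close>, so the Hamiltonian equation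
    applies to it; this supplies the first-order term in the derivative of
    \<open>dderiv (T y) f y\<close>.\<close>
  moreover have "\<omega> x (T' v) (X x) = - c * dderiv (T' v) f x"
    using ham[OF x T'] form_antisym[of x "T' v" "X x"] by simp
  moreover have "dderiv (X x) (\<lambda>y. \<omega> y v (T x)) x = - dderiv (X x) (\<lambda>y. \<omega> y (T x) v) x"
    by (simp add: dderiv_form[OF x])
  moreover have "dderiv v (\<lambda>y. dderiv (T y) f y) x = dderiv (T x) (dderiv v f) x + dderiv (T' v) f x"
    using dderiv_dderiv_field[OF open_W x f T] dderiv_commute[OF open_W f x] by simp
  ultimately show ?thesis
    using form_closed[OF x, of "T x" "X x" v] bilinear_form[OF x]
    by (simp add: bilinear_lsub algebra_simps)
qed

end

subsection \<open>Gradients, horizontal lifts and Poisson brackets\<close>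

text \<open>\<open>jvec\<close> is the adjoint of \<open>d\<^sup>c\<close>: \<open>d\<^sup>c f(v) = df(jvec v)\<close>.  On the total space, \<open>jfib\<close> makes \<open>ddj jfib \<Phi>\<close>
  the full exterior derivative of the fibrewise \<open>d\<^sup>c \<Phi>\<close>.\<close>

definition jvec :: "complex^'n \<Rightarrow> complex^'n" where
  "jvec v = (- 1 / (2 * pi)) *\<^sub>R (\<i> *s v)"

definition jfib :: "'p::euclidean_space \<times> (complex^'n) \<Rightarrow> 'p \<times> (complex^'n)" where
  "jfib x = (0, jvec (snd x))"

lemma jfib_Pair: "jfib (a, v) = (0, jvec v)"
  by (simp add: jfib_def)

lemma linear_jvec: "linear jvec"
  by (rule linearI) (auto simp: jvec_def vec_eq_iff algebra_simps)

lemma jvec_0 [simp]: "jvec 0 = 0"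
  by (rule linear_0[OF linear_jvec])

lemma jvec_jvec: "jvec (jvec v) = - (1 / (4 * pi\<^sup>2)) *\<^sub>R v"
  by (auto simp: jvec_def vec_eq_iff power2_eq_square complex_eq_iff)

lemma i_jvec: "jvec (\<i> *s v) = (1 / (2 * pi)) *\<^sub>R v"
  by (auto simp: jvec_def vec_eq_iff complex_eq_iff)

lemma linear_jfib: "linear jfib"
  by (rule linearI) (auto simp: jfib_def linear_add[OF linear_jvec] linear_scale[OF linear_jvec])

text \<open>The defining equation says that contracting the form with the gradient gives
  \<open>d\<^sup>c f\<close> on the fibre.\<close>

definition vgrad ::
    "('p::euclidean_space \<times> (complex^'n) \<Rightarrow> real) \<Rightarrow> ('p \<times> (complex^'n) \<Rightarrow> real) \<Rightarrow> 'p \<times> (complex^'n) \<Rightarrow> complex^'n"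
  where "vgrad \<Phi> f x = (THE w. \<forall>v. ddj jfib \<Phi> x (0, w) (0, v) = dderiv (0, jvec v) f x)"

definition horizontal ::
    "('p::euclidean_space \<times> (complex^'n) \<Rightarrow> real) \<Rightarrow> 'p \<Rightarrow> 'p \<times> (complex^'n) \<Rightarrow> 'p \<times> (complex^'n)" where
  "horizontal \<Phi> e x = (e, - vgrad \<Phi> (dderiv (e, 0) \<Phi>) x)"

text \<open>The usual Hamiltonian field and Poisson bracket, divided by \<open>4\<pi>\<^sup>2\<close>.\<close>

definition hamiltonian ::
    "('p::euclidean_space \<times> (complex^'n) \<Rightarrow> real) \<Rightarrow> ('p \<times> (complex^'n) \<Rightarrow> real) \<Rightarrow>
      'p \<times> (complex^'n) \<Rightarrow> 'p \<times> (complex^'n)" where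
  "hamiltonian \<Phi> f x = (0, jvec (vgrad \<Phi> f x))"

definition bracket ::
    "('p::euclidean_space \<times> (complex^'n) \<Rightarrow> real) \<Rightarrow> ('p \<times> (complex^'n) \<Rightarrow> real) \<Rightarrow>
      ('p \<times> (complex^'n) \<Rightarrow> real) \<Rightarrow> 'p \<times> (complex^'n) \<Rightarrow> real" where
  "bracket \<Phi> f g x = dderiv (hamiltonian \<Phi> f x) g x"

text \<open>Weaker than positivity, but given by a nonvanishing determinant, hence open: it persists
  in a neighbourhood of the points where positivity is assumed.\<close>

definition nondegenerate :: "('p::euclidean_space \<times> (complex^'n) \<Rightarrow> real) \<Rightarrow> 'p \<times> (complex^'n) \<Rightarrow> bool" where
  "nondegenerate \<Phi> x \<longleftrightarrow> (\<forall>w. (\<forall>v. ddj jfib \<Phi> x (0, w) (0, v) = 0) \<longrightarrow> w = 0)"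

subsection \<open>Nondegeneracy in real coordinates\<close>

text \<open>The real basis formed by 1 and \<open>\<i>\<close> in every coordinate; the index type
  makes the fibre form a square real matrix.\<close>

definition rbasis :: "'n \<times> bool \<Rightarrow> complex^'n" where
  "rbasis k = axis (fst k) (if snd k then \<i> else 1)"

definition rcomb :: "real^('n \<times> bool) \<Rightarrow> complex^'n" where
  "rcomb c = (\<Sum>k\<in>UNIV. c $ k *\<^sub>R rbasis k)"

lemma rcomb_nth: "rcomb c $ i = Complex (c $ (i, False)) (c $ (i, True))"
proof -
  have "rcomb c $ i = (\<Sum>j\<in>UNIV. \<Sum>b\<in>UNIV. c $ (j, b) *\<^sub>R rbasis (j, b) $ i)"
    unfolding rcomb_def sum.cartesian_product by (simp add: UNIV_Times_UNIV)
  also have "\<dots> = (\<Sum>j\<in>UNIV. if j = i then Complex (c $ (i, False)) (c $ (i, True)) else 0)"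
    by (rule sum.cong) (auto simp: rbasis_def axis_def UNIV_bool complex_eq_iff)
  finally show ?thesis by simp
qed

lemma rcomb_eq_0: "rcomb c = 0 \<longleftrightarrow> c = 0"
  by (auto simp: vec_eq_iff rcomb_nth complex_eq_iff zero_complex.code) (metis (full_types))

lemma rcomb_surj: "\<exists>c. rcomb c = v"
  by (rule exI[of _ "\<chi> k. if snd k then Im (v $ fst k) else Re (v $ fst k)"])
    (simp add: vec_eq_iff rcomb_nth)

definition form_matrix ::
    "('p::euclidean_space \<times> (complex^'n) \<Rightarrow> real) \<Rightarrow> 'p \<times> (complex^'n) \<Rightarrow> real^('n \<times> bool)^('n \<times> bool)" where
  "form_matrix \<Phi> x = (\<chi> i k. ddj jfib \<Phi> x (0, rbasis k) (0, rbasis i))"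

lemma bilinear_imp_linear:
  assumes "bilinear f"
  shows "linear (f a)" "linear (\<lambda>b. f b a)"
  using assms by (auto simp: bilinear_def)

locale fibre_potential = potential W \<Phi> jfib
  for W :: "('p::euclidean_space \<times> (complex^'n)) set" and \<Phi>
begin

lemma linear_form_vertical:
  assumes "x \<in> W"
  shows "linear (\<lambda>v. \<omega> x a (0, v))" "linear (\<lambda>v. \<omega> x (0, v) a)"
proof -
  have "linear (Pair 0 :: complex^'n \<Rightarrow> 'p \<times> (complex^'n))"
    by (auto intro: linearI)
  from linear_compose[OF this, of "\<omega> x a"] linear_compose[OF this, of "\<lambda>b. \<omega> x b a"]
  show "linear (\<lambda>v. \<omega> x a (0, v))" "linear (\<lambda>v. \<omega> x (0, v) a)"
    using bilinear_imp_linear[OF bilinear_form[OF assms]] by (simp_all add: o_def)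
qed

lemma linear_rcomb_ext:
  assumes L: "linear (L :: complex^'n \<Rightarrow> real)" and "\<And>k. L (rbasis k) = 0"
  shows "L v = 0"
proof -
  obtain c where "v = rcomb c" using rcomb_surj by metis
  then show ?thesis
    by (simp add: rcomb_def linear_sum[OF L] linear_scale[OF L] assms)
qed

lemma form_matrix_mult:
  assumes "x \<in> W"
  shows "(form_matrix \<Phi> x *v c) $ i = \<omega> x (0, rcomb c) (0, rbasis i)"
  by (simp add: form_matrix_def matrix_vector_mult_def rcomb_def mult.commute
      linear_sum[OF linear_form_vertical(2)[OF assms]]
      linear_scale[OF linear_form_vertical(2)[OF assms]])

text \<open>The kernel of the matrix consists of the coordinates of vectors that pair to zero with
  the whole fibre. The determinant then gives openness and access to Cramer's rule.\<close>

lemma nondegenerate_iff_det: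
  assumes x: "x \<in> W"
  shows "nondegenerate \<Phi> x \<longleftrightarrow> det (form_matrix \<Phi> x) \<noteq> 0"
proof -
  have "form_matrix \<Phi> x *v c = 0 \<longleftrightarrow> (\<forall>v. \<omega> x (0, rcomb c) (0, v) = 0)" for c
    using linear_rcomb_ext[OF linear_form_vertical(1)[OF x]]
    by (auto simp: vec_eq_iff form_matrix_mult[OF x])
  moreover have "(\<forall>w. Q w) \<longleftrightarrow> (\<forall>c. Q (rcomb c))" for Q :: "complex^'n \<Rightarrow> bool"
    using rcomb_surj by metis
  from this[of "\<lambda>w. (\<forall>v. \<omega> x (0, w) (0, v) = 0) \<longrightarrow> w = 0"]
  have "nondegenerate \<Phi> x \<longleftrightarrow> (\<forall>c. (\<forall>v. \<omega> x (0, rcomb c) (0, v) = 0) \<longrightarrow> c = 0)"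
    by (simp only: nondegenerate_def rcomb_eq_0)
  ultimately have "(\<forall>c. form_matrix \<Phi> x *v c = 0 \<longrightarrow> c = 0) \<longleftrightarrow> nondegenerate \<Phi> x"
    by simp
  then show ?thesis
    using matrix_left_invertible_ker[of "form_matrix \<Phi> x"] invertible_det_nz[of "form_matrix \<Phi> x"]
      invertible_left_inverse[of "form_matrix \<Phi> x"] by simp
qed

lemma smooth_det: "smooth_on (\<lambda>x. det (form_matrix \<Phi> x)) W"
  by (rule smooth_on_det[OF open_W]) (simp add: form_matrix_def smooth_form)

lemma open_nondegenerate: "open {x \<in> W. nondegenerate \<Phi> x}"
proof -
  have "open (W \<inter> (\<lambda>x. det (form_matrix \<Phi> x)) -` (- {0}))"
    using continuous_open_preimage[OF smooth_on_continuous[OF smooth_det] open_W] by auto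
  also have "W \<inter> (\<lambda>x. det (form_matrix \<Phi> x)) -` (- {0}) = {x \<in> W. nondegenerate \<Phi> x}"
    using nondegenerate_iff_det by auto
  finally show ?thesis .
qed

lemma dderiv_0_pot: "x \<in> W \<Longrightarrow> dderiv 0 \<Phi> x = 0"
  using linear_0[OF linear_dderiv_on[OF smooth_pot]] .

text \<open>\<open>jfib\<close> annihilates base directions, so one Hessian term survives when only
  the first argument is a base vector, and none when both are.\<close>

lemma form_base:
  assumes "x \<in> W"
  shows "\<omega> x (e, 0) (0, v) = dderiv (0, jvec v) (dderiv (e, 0) \<Phi>) x" "\<omega> x (e, 0) (e', 0) = 0"
proof -
  have zero: "dderiv u (dderiv (0, 0) \<Phi>) x = 0" for u
    using dderiv_zero_on[OF assms dderiv_0_pot] by (simp add: zero_prod_def)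
  show "\<omega> x (e, 0) (0, v) = dderiv (0, jvec v) (dderiv (e, 0) \<Phi>) x" "\<omega> x (e, 0) (e', 0) = 0"
    using dderiv_commute[OF open_W smooth_pot assms, of "(e, 0)"]
    by (simp_all only: ddj_def jfib_Pair jvec_0 zero diff_zero)
qed

text \<open>The form has type (1,1) on the fibres, so a multiple of the complex structure is skew
  for it. Concretely, \<open>jvec\<close> squares to a scalar and the Hessian is symmetric.\<close>

lemma form_jvec:
  assumes x: "x \<in> W"
  shows "\<omega> x (0, jvec w) (0, v) = - \<omega> x (0, w) (0, jvec v)"
proof -
  define k where "k = - (1 / (4 * pi\<^sup>2))"
  have k: "jvec (jvec u) = k *\<^sub>R u" for u :: "complex^'n"
    by (simp add: jvec_jvec k_def)
  have H: "dderiv a (dderiv (0, k *\<^sub>R b) \<Phi>) x = k * dderiv a (dderiv (0, b) \<Phi>) x" for a b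
    using linear_scale[OF bilinear_imp_linear(1)[OF bilinear_hessian[OF x]], of a k "(0, b)"] by simp
  show ?thesis
    unfolding ddj_def jfib_Pair k H
    using dderiv_commute[OF open_W smooth_pot x, of "(0, jvec w)" "(0, jvec v)"]
      dderiv_commute[OF open_W smooth_pot x, of "(0, w)" "(0, v)"] by simp
qed

end

section \<open>Smoothness and defining equations of gradients, horizontal lifts and Hamiltonian
  fields\<close>

locale nondegenerate_potential = fibre_potential W \<Phi>
  for W :: "('p::euclidean_space \<times> (complex^'n)) set" and \<Phi> +
  assumes nondeg: "x \<in> W \<Longrightarrow> nondegenerate \<Phi> x"
begin

lemma form_eqI:
  assumes x: "x \<in> W" and ab: "a \<in> {0} \<times> UNIV" "b \<in> {0} \<times> UNIV"
    and eq: "\<And>v. v \<in> {0} \<times> UNIV \<Longrightarrow> \<omega> x a v = \<omega> x b v"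
  shows "a = b"
proof -
  have "\<omega> x (a - b) v = 0" if "v \<in> {0} \<times> UNIV" for v
    using eq[OF that] bilinear_lsub[OF bilinear_form[OF x]] by simp
  moreover have "a - b = (0, snd a - snd b)" using ab by (auto simp: mem_Times_iff prod_eq_iff)
  ultimately have "\<omega> x (0, snd a - snd b) (0, v) = 0" for v by simp
  then have "snd a - snd b = 0"
    using nondeg[OF x, unfolded nondegenerate_def] by blast
  then show ?thesis using ab by (auto simp: mem_Times_iff prod_eq_iff)
qed

text \<open>Cramer's rule for the gradient equation: quotients of determinants make smoothness in
  all variables visible, which the definite description in \<open>vgrad\<close> does not.\<close>

definition grad_coords :: "('p \<times> (complex^'n) \<Rightarrow> real) \<Rightarrow> 'p \<times> (complex^'n) \<Rightarrow> real^('n \<times> bool)" where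
  "grad_coords f x = (\<chi> k. det (\<chi> i l. if l = k then dderiv (0, jvec (rbasis i)) f x
      else form_matrix \<Phi> x $ i $ l) / det (form_matrix \<Phi> x))"

lemma form_grad_coords:
  assumes x: "x \<in> W" and f: "smooth_on f W"
  shows "\<omega> x (0, rcomb (grad_coords f x)) (0, v) = dderiv (0, jvec v) f x"
proof -
  have "det (form_matrix \<Phi> x) \<noteq> 0" using nondegenerate_iff_det nondeg x by blast
  then have "form_matrix \<Phi> x *v grad_coords f x = (\<chi> i. dderiv (0, jvec (rbasis i)) f x)"
    by (simp add: cramer grad_coords_def cong: if_cong)
  then have "\<omega> x (0, rcomb (grad_coords f x)) (0, rbasis i) - dderiv (0, jvec (rbasis i)) f x = 0" for i
    by (simp flip: form_matrix_mult[OF x])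
  moreover have "linear (\<lambda>v. dderiv (0, jvec v) f x)"
  proof -
    have "linear (\<lambda>v :: complex^'n. (0 :: 'p, jvec v))"
      by (rule linearI) (simp_all add: linear_add[OF linear_jvec] linear_scale[OF linear_jvec])
    from linear_compose[OF this linear_dderiv_on[OF f x]] show ?thesis by (simp add: o_def)
  qed
  ultimately show ?thesis
    using linear_rcomb_ext[OF linear_compose_sub[OF linear_form_vertical(1)[OF x]], of
        "\<lambda>v. dderiv (0, jvec v) f x" "(0, rcomb (grad_coords f x))" v] by simp
qed

lemma vgrad_eq:
  assumes x: "x \<in> W" and f: "smooth_on f W"
  shows "vgrad \<Phi> f x = rcomb (grad_coords f x)"
  unfolding vgrad_def
proof (rule the_equality)
  fix w assume "\<forall>v. \<omega> x (0, w) (0, v) = dderiv (0, jvec v) f x"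
  then have "(0 :: 'p, w) = (0, rcomb (grad_coords f x))"
    by (intro form_eqI[OF x]) (auto simp: form_grad_coords[OF assms])
  then show "w = rcomb (grad_coords f x)" by simp
qed (simp add: form_grad_coords[OF assms])

lemma form_vgrad:
  assumes "x \<in> W" "smooth_on f W"
  shows "\<omega> x (0, vgrad \<Phi> f x) (0, v) = dderiv (0, jvec v) f x"
  by (simp add: vgrad_eq[OF assms] form_grad_coords[OF assms])

lemma smooth_vgrad:
  assumes f: "smooth_on f W"
  shows "smooth_field (vgrad \<Phi> f) W"
  unfolding smooth_field_def
proof
  fix b
  have "smooth_on (\<lambda>x. grad_coords f x $ k) W" for k
  proof -
    have "smooth_on (\<lambda>x. (\<chi> i l. if l = k then dderiv (0, jvec (rbasis i)) f x
      else form_matrix \<Phi> x $ i $ l) $ i $ l) W" for i l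
      by (cases "l = k") (simp_all add: form_matrix_def smooth_form smooth_on_dderiv f)
    then show ?thesis
      using nondegenerate_iff_det nondeg unfolding grad_coords_def
      by (simp only: vec_lambda_beta) (intro smooth_on_divide smooth_on_det open_W smooth_det, auto)
  qed
  then have "smooth_on (\<lambda>x. \<Sum>k\<in>UNIV. grad_coords f x $ k * (rbasis k \<bullet> b)) W"
    by (intro smooth_on_sum smooth_on_mult open_W smooth_on_const)
  then show "smooth_on (\<lambda>x. vgrad \<Phi> f x \<bullet> b) W"
    by (rule smooth_on_cong[OF open_W, rotated])
      (simp add: vgrad_eq[OF _ f] rcomb_def inner_sum_left)
qed

lemma smooth_horizontal: "smooth_field (horizontal \<Phi> e) W"
  using smooth_vgrad[OF smooth_on_dderiv[OF smooth_pot, of "(e, 0)"]]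
  by (auto simp: smooth_field_def horizontal_def inner_prod_def
      intro!: smooth_on_diff open_W smooth_on_const)

lemma smooth_hamiltonian:
  assumes "smooth_on f W"
  shows "smooth_field (hamiltonian \<Phi> f) W"
  unfolding smooth_field_def
proof
  fix b :: "'p \<times> (complex^'n)"
  have "smooth_on (\<lambda>x. jvec (vgrad \<Phi> f x) \<bullet> snd b) W"
    by (rule smooth_on_pairing[OF open_W _ smooth_on_const smooth_vgrad[OF assms]])
      (auto intro!: linearI simp: linear_add[OF linear_jvec] linear_scale[OF linear_jvec]
        inner_add_left)
  then show "smooth_on (\<lambda>x. hamiltonian \<Phi> f x \<bullet> b) W"
    by (simp add: hamiltonian_def inner_prod_def)
qed

lemma smooth_bracket: "smooth_on f W \<Longrightarrow> smooth_on g W \<Longrightarrow> smooth_on (bracket \<Phi> f g) W"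
  unfolding bracket_def using smooth_on_dderiv_field[OF open_W _ smooth_hamiltonian] by blast

lemma smooth_horizontal_deriv: "smooth_on f W \<Longrightarrow> smooth_on (\<lambda>y. dderiv (horizontal \<Phi> e y) f y) W"
  using smooth_on_dderiv_field[OF open_W _ smooth_horizontal] by blast

lemma form_horizontal:
  assumes "x \<in> W" "v \<in> {0} \<times> UNIV"
  shows "\<omega> x (horizontal \<Phi> e x) v = 0"
proof -
  obtain u where v: "v = (0, u)" using assms(2) by auto
  have "\<omega> x ((e, 0) - (0, g)) (0, u) = \<omega> x (e, 0) (0, u) - \<omega> x (0, g) (0, u)" for g
    by (rule bilinear_lsub[OF bilinear_form[OF assms(1)]])
  then have "\<omega> x (horizontal \<Phi> e x) v = \<omega> x (e, 0) (0, u)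
      - \<omega> x (0, vgrad \<Phi> (dderiv (e, 0) \<Phi>) x) (0, u)"
    by (simp add: horizontal_def v)
  then show ?thesis
    by (simp add: form_base[OF assms(1)] form_vgrad[OF assms(1) smooth_on_dderiv[OF smooth_pot]])
qed

text \<open>Moving \<open>jvec\<close> to the other slot and using the gradient equation leaves
  \<open>jvec (jvec u)\<close>, whose scalar produces the constant.\<close>

lemma form_hamiltonian:
  assumes "x \<in> W" "smooth_on f W" "v \<in> {0} \<times> UNIV"
  shows "\<omega> x (hamiltonian \<Phi> f x) v = 1 / (4 * pi\<^sup>2) * dderiv v f x"
proof -
  obtain u where v: "v = (0, u)" using assms(3) by auto
  have "\<omega> x (hamiltonian \<Phi> f x) v = - dderiv (0, jvec (jvec u)) f x"
    by (simp add: hamiltonian_def v form_jvec[OF assms(1)] form_vgrad[OF assms(1,2)])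
  also have "(0, jvec (jvec u)) = - (1 / (4 * pi\<^sup>2)) *\<^sub>R v"
    by (simp add: jvec_jvec v)
  finally show ?thesis by (simp only: linear_scale[OF linear_dderiv_on[OF assms(2,1)]]) simp
qed

text \<open>The base component of the field is the constant \<open>e\<close>. Verticality of
  \<open>T'\<close> is what \<open>form_commutator\<close> and
  \<open>form_hamiltonian_bracket\<close> require.\<close>

lemma horizontal_deriv_vertical:
  assumes "(horizontal \<Phi> e has_derivative T') (at x)"
  shows "T' u \<in> {0} \<times> UNIV"
proof -
  have "((\<lambda>y. fst (horizontal \<Phi> e y)) has_derivative (\<lambda>u. fst (T' u))) (at x)"
    using assms by (rule has_derivative_fst)
  then have "((\<lambda>y. e) has_derivative (\<lambda>u. fst (T' u))) (at x)"
    by (simp add: horizontal_def)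
  then have "(\<lambda>u. fst (T' u)) = (\<lambda>u. 0)"
    using has_derivative_unique has_derivative_const by blast
  then show ?thesis by (metis mem_Times_iff UNIV_I singleton_iff)
qed

lemma hamiltonian_deriv_vertical:
  assumes "(hamiltonian \<Phi> f has_derivative T') (at x)"
  shows "T' u \<in> {0} \<times> UNIV"
proof -
  have "((\<lambda>y. fst (hamiltonian \<Phi> f y)) has_derivative (\<lambda>u. fst (T' u))) (at x)"
    using assms by (rule has_derivative_fst)
  then have "((\<lambda>y. 0) has_derivative (\<lambda>u. fst (T' u))) (at x)"
    by (simp add: hamiltonian_def)
  then have "(\<lambda>u. fst (T' u)) = (\<lambda>u. 0)"
    using has_derivative_unique has_derivative_const by blast
  then show ?thesis by (metis mem_Times_iff UNIV_I singleton_iff)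
qed

section \<open>Commutators of horizontal lifts and the Poisson bracket\<close>

lemma form_horizontal_horizontal:
  assumes x: "x \<in> W"
  shows "\<omega> x (horizontal \<Phi> e x) (horizontal \<Phi> e' x)
    = bracket \<Phi> (dderiv (e, 0) \<Phi>) (dderiv (e', 0) \<Phi>) x"
proof -
  let ?g = "vgrad \<Phi> (dderiv (e, 0) \<Phi>) x"
  \<comment> \<open>The vertical part of the second lift is orthogonal to the first lift, so only
    the base vector \<open>(e', 0)\<close> counts.\<close>
  have "\<omega> x (horizontal \<Phi> e x) ((e', 0) + (0, - vgrad \<Phi> (dderiv (e', 0) \<Phi>) x))
      = \<omega> x (horizontal \<Phi> e x) (e', 0)"
    using form_horizontal[OF x] by (simp add: bilinear_radd[OF bilinear_form[OF x]] del: add_Pair)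
  then have "\<omega> x (horizontal \<Phi> e x) (horizontal \<Phi> e' x) = - \<omega> x (e', 0) (horizontal \<Phi> e x)"
    using form_antisym[of x "horizontal \<Phi> e x"] by (simp add: horizontal_def[of _ e'])
  also have "horizontal \<Phi> e x = (e, 0) - (0, ?g)"
    by (simp add: horizontal_def)
  also have "- \<omega> x (e', 0) ((e, 0) - (0, ?g)) = \<omega> x (e', 0) (0, ?g)"
    by (simp only: bilinear_rsub[OF bilinear_form[OF x]] form_base[OF x])
  also have "\<dots> = bracket \<Phi> (dderiv (e, 0) \<Phi>) (dderiv (e', 0) \<Phi>) x"
    by (simp add: form_base[OF x] bracket_def hamiltonian_def)
  finally show ?thesis by (simp add: horizontal_def[of _ e])
qed

text \<open>The second-order terms cancel, leaving the derivative along the Lie bracket of the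
  lifts. By \<open>form_commutator\<close> and nondegeneracy that bracket is a Hamiltonian field;
  \<open>4 * pi\<^sup>2\<close> undoes the normalization of \<open>hamiltonian\<close>.\<close>

theorem horizontal_commutator:
  assumes x: "x \<in> W" and \<psi>: "smooth_on \<psi> W"
  shows "dderiv (horizontal \<Phi> e x) (\<lambda>y. dderiv (horizontal \<Phi> e' y) \<psi> y) x
      - dderiv (horizontal \<Phi> e' x) (\<lambda>y. dderiv (horizontal \<Phi> e y) \<psi> y) x
    = 4 * pi\<^sup>2 * bracket \<Phi> (bracket \<Phi> (dderiv (e, 0) \<Phi>) (dderiv (e', 0) \<Phi>)) \<psi> x"
proof -
  let ?T = "horizontal \<Phi> e" and ?S = "horizontal \<Phi> e'"
  let ?h = "bracket \<Phi> (dderiv (e, 0) \<Phi>) (dderiv (e', 0) \<Phi>)"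
  obtain T' S' where T: "(?T has_derivative T') (at x)" and S: "(?S has_derivative S') (at x)"
    using smooth_field_has_derivative[OF smooth_horizontal x] by blast
  note T' = horizontal_deriv_vertical[OF T] and S' = horizontal_deriv_vertical[OF S]
  have h: "smooth_on ?h W"
    by (intro smooth_bracket smooth_on_dderiv smooth_pot)
  have "\<omega> x (S' (?T x) - T' (?S x)) v = \<omega> x ((4 * pi\<^sup>2) *\<^sub>R hamiltonian \<Phi> ?h x) v"
    if v: "v \<in> {0} \<times> UNIV" for v
  proof -
    have "\<omega> x (S' (?T x) - T' (?S x)) v = dderiv v (\<lambda>y. \<omega> y (?T y) (?S y)) x"
      by (rule form_commutator[OF x T S form_horizontal form_horizontal T' S' v, symmetric])
    also have "\<dots> = dderiv v ?h x"
      by (rule dderiv_cong_open[OF open_W x form_horizontal_horizontal])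
    finally show ?thesis
      using form_hamiltonian[OF x h v] by (simp add: bilinear_lmul[OF bilinear_form[OF x]])
  qed
  moreover have "S' (?T x) - T' (?S x) \<in> {0} \<times> UNIV"
    using T'[of "?S x"] S'[of "?T x"] by (auto simp: mem_Times_iff)
  ultimately have "S' (?T x) - T' (?S x) = (4 * pi\<^sup>2) *\<^sub>R hamiltonian \<Phi> ?h x"
    by (intro form_eqI[OF x]) (auto simp: hamiltonian_def)
  then have "dderiv (S' (?T x)) \<psi> x - dderiv (T' (?S x)) \<psi> x
      = 4 * pi\<^sup>2 * dderiv (hamiltonian \<Phi> ?h x) \<psi> x"
    using linear_diff[OF linear_dderiv_on[OF \<psi> x], of "S' (?T x)" "T' (?S x)"]
    by (simp add: linear_scale[OF linear_dderiv_on[OF \<psi> x]])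
  then show ?thesis
    using dderiv_commute[OF open_W \<psi> x, of "?T x"]
    by (simp add: dderiv_dderiv_field[OF open_W x \<psi> T] dderiv_dderiv_field[OF open_W x \<psi> S] bracket_def)
qed

text \<open>By \<open>form_hamiltonian_bracket\<close> and nondegeneracy, the Lie bracket of the
  lift with the Hamiltonian field of \<open>f\<close> is the Hamiltonian field of the derivative of
  \<open>f\<close>. Applied to \<open>g\<close>, this is the Leibniz rule.\<close>

theorem horizontal_bracket:
  assumes x: "x \<in> W" and f: "smooth_on f W" and g: "smooth_on g W"
  shows "dderiv (horizontal \<Phi> e x) (bracket \<Phi> f g) x
    = bracket \<Phi> (\<lambda>y. dderiv (horizontal \<Phi> e y) f y) g x
      + bracket \<Phi> f (\<lambda>y. dderiv (horizontal \<Phi> e y) g y) x"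
proof -
  let ?T = "horizontal \<Phi> e" and ?X = "hamiltonian \<Phi> f"
  let ?h = "\<lambda>y. dderiv (?T y) f y"
  obtain T' X' where T: "(?T has_derivative T') (at x)" and X: "(?X has_derivative X') (at x)"
    using smooth_field_has_derivative[OF smooth_horizontal x]
      smooth_field_has_derivative[OF smooth_hamiltonian[OF f] x] by blast
  note T' = horizontal_deriv_vertical[OF T] and X' = hamiltonian_deriv_vertical[OF X]
  have X_vertical: "?X x \<in> {0} \<times> UNIV" by (simp add: hamiltonian_def)
  have "\<omega> x (X' (?T x) - T' (?X x)) v = \<omega> x (hamiltonian \<Phi> ?h x) v"
    if v: "v \<in> {0} \<times> UNIV" for v
    using form_hamiltonian_bracket[OF x f T form_horizontal form_hamiltonian[OF _ f] T' X X_vertical v]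
      form_hamiltonian[OF x smooth_horizontal_deriv[OF f] v] by simp
  moreover have "X' (?T x) - T' (?X x) \<in> {0} \<times> UNIV"
    using T'[of "?X x"] X'[of "?T x"] by (auto simp: mem_Times_iff)
  ultimately have "X' (?T x) - T' (?X x) = hamiltonian \<Phi> ?h x"
    by (intro form_eqI[OF x]) (auto simp: hamiltonian_def)
  then have "dderiv (X' (?T x)) g x - dderiv (T' (?X x)) g x = bracket \<Phi> ?h g x"
    using linear_diff[OF linear_dderiv_on[OF g x], of "X' (?T x)" "T' (?X x)"]
    by (simp add: bracket_def)
  then show ?thesis
    using dderiv_commute[OF open_W g x, of "?T x"]
    by (simp add: bracket_def[abs_def] dderiv_dderiv_field[OF open_W x g T]
        dderiv_dderiv_field[OF open_W x g X])
qed

end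

subsection \<open>Restriction to the fibres\<close>

lemma vgrad_cong:
  assumes "open W" "x \<in> W" "\<And>y. y \<in> W \<Longrightarrow> f y = g y"
  shows "vgrad \<Phi> f x = vgrad \<Phi> g x"
  by (simp add: vgrad_def dderiv_cong_open[OF assms])

text \<open>Allows an inner bracket to be rewritten by an identity that is valid on \<open>W\<close>
  only.\<close>

lemma bracket_cong_left:
  assumes "open W" "x \<in> W" "\<And>y. y \<in> W \<Longrightarrow> f y = g y"
  shows "bracket \<Phi> f h x = bracket \<Phi> g h x"
  by (simp add: bracket_def hamiltonian_def vgrad_cong[OF assms])

context nondegenerate_potential
begin

lemma bracket_add_left:
  assumes x: "x \<in> W" and f: "smooth_on f W" and g: "smooth_on g W" and h: "smooth_on h W"
  shows "bracket \<Phi> (\<lambda>y. f y + g y) h x = bracket \<Phi> f h x + bracket \<Phi> g h x"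
proof -
  have "hamiltonian \<Phi> (\<lambda>y. f y + g y) x = hamiltonian \<Phi> f x + hamiltonian \<Phi> g x"
  proof (rule form_eqI[OF x])
    fix v :: "'p \<times> (complex^'n)" assume v: "v \<in> {0} \<times> UNIV"
    have "dderiv v (\<lambda>y. f y + g y) x = dderiv v f x + dderiv v g x"
      by (rule dderiv_eq, intro has_derivative_add smooth_on_has_derivative[OF _ x] f g)
    then show "\<omega> x (hamiltonian \<Phi> (\<lambda>y. f y + g y) x) v
        = \<omega> x (hamiltonian \<Phi> f x + hamiltonian \<Phi> g x) v"
      using form_hamiltonian[OF x _ v] f g smooth_on_add[OF open_W f g]
      by (simp add: bilinear_ladd[OF bilinear_form[OF x]] distrib_left add_divide_distrib)
  qed (auto simp: hamiltonian_def)
  then show ?thesis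
    using linear_add[OF linear_dderiv_on[OF h x]] by (simp add: bracket_def)
qed

end

lemma dform_eq_dderiv: "dform f z v = dderiv v f z"
  by (simp add: dform_def dderiv_def)

lemma dc_form_eq: "dc_form f z v = - dderiv (\<i> *s v) f z / (2 * pi)"
  by (simp add: dc_form_def dbar_form_def partial_form_def dform_eq_dderiv field_simps)

text \<open>Only the values of \<open>f\<close> on the slice of \<open>W\<close> matter: covariant derivatives are junk elsewhere.\<close>

definition agrees ::
    "('p \<times> 'a) set \<Rightarrow> 'p \<Rightarrow> ('a \<Rightarrow> real) \<Rightarrow> ('p \<times> 'a \<Rightarrow> real) \<Rightarrow> bool" where
  "agrees W p f F \<longleftrightarrow> (\<forall>z. (p, z) \<in> W \<longrightarrow> f z = F (p, z))"

lemma agreesD: "agrees W p f F \<Longrightarrow> (p, z) \<in> W \<Longrightarrow> f z = F (p, z)"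
  by (simp add: agrees_def)

lemma open_slice:
  assumes "open W"
  shows "open {z. (p, z) \<in> W}"
proof -
  have "continuous_on UNIV (\<lambda>z. (p, z))"
    by (intro continuous_intros)
  from open_vimage[OF assms this] show ?thesis by (simp add: vimage_def)
qed

lemma bounded_linear_zero_Pair: "bounded_linear (Pair 0)"
  using bounded_linear_Pair[OF bounded_linear_zero bounded_linear_ident] by simp

lemma agrees_smooth:
  fixes f :: "'a::euclidean_space \<Rightarrow> real" and p :: "'p::euclidean_space"
  assumes "open W" "smooth_on F W" "agrees W p f F"
  shows "smooth_on f {z. (p, z) \<in> W}"
proof (rule smooth_on_cong[OF open_slice[OF assms(1)]])
  show "smooth_on (\<lambda>z. F ((0, z) + (p, 0))) {z. (p, z) \<in> W}"
    by (rule smooth_on_compose_affine[OF bounded_linear_zero_Pair assms(2) open_slice[OF assms(1)]]) simp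
qed (use agreesD[OF assms(3)] in simp)

lemma agrees_dderiv:
  fixes f :: "'a::euclidean_space \<Rightarrow> real" and p :: "'p::euclidean_space"
  assumes W: "open W" and F: "smooth_on F W" and f: "agrees W p f F"
  shows "agrees W p (dderiv v f) (dderiv (0, v) F)"
  unfolding agrees_def
proof (intro allI impI)
  fix z assume z: "(p, z) \<in> W"
  have "(F has_derivative (\<lambda>v. dderiv v F (p, z))) (at (p, z))"
    by (rule smooth_on_has_derivative[OF F z])
  moreover have "((\<lambda>y. (p, y)) has_derivative (\<lambda>v. (0, v))) (at z)"
    by (auto intro!: derivative_eq_intros)
  ultimately have "((\<lambda>y. F (p, y)) has_derivative (\<lambda>v. dderiv (0, v) F (p, z))) (at z)"
    by (rule has_derivative_compose[rotated])
  then have "(f has_derivative (\<lambda>v. dderiv (0, v) F (p, z))) (at z)"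
    by (rule has_derivative_transform_within_open[OF _ open_slice[OF W]])
      (use z agreesD[OF f] in auto)
  then show "dderiv v f z = dderiv (0, v) F (p, z)" by (rule dderiv_eq)
qed

text \<open>Openness of \<open>W\<close> keeps \<open>(\<gamma> \<tau>, z)\<close> inside for
  \<open>\<tau>\<close> near \<open>t\<close>, so the chain rule for \<open>F\<close> along
  \<open>\<gamma>\<close> carries over to \<open>\<theta>\<close>.\<close>

lemma agrees_velocity:
  fixes \<theta> :: "real \<Rightarrow> complex^'n \<Rightarrow> real" and \<gamma> :: "real \<Rightarrow> 'p::euclidean_space"
  assumes W: "open W" and F: "smooth_on F W" and \<theta>: "\<And>\<tau>. agrees W (\<gamma> \<tau>) (\<theta> \<tau>) F"
    and \<gamma>: "\<And>\<tau>. (\<gamma> has_vector_derivative e) (at \<tau>)"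
  shows "agrees W (\<gamma> t) (velocity \<theta> t) (dderiv (e, 0) F)"
  unfolding agrees_def
proof (intro allI impI)
  fix z assume z: "(\<gamma> t, z) \<in> W"
  have cont: "continuous_on UNIV \<gamma>"
    by (rule continuous_at_imp_continuous_on)
      (use \<gamma> has_vector_derivative_continuous in blast)
  have op: "open {\<tau>. (\<gamma> \<tau>, z) \<in> W}"
    using open_vimage[OF W continuous_on_Pair[OF cont continuous_on_const]]
    by (simp add: vimage_def)
  have "(F has_derivative (\<lambda>v. dderiv v F (\<gamma> t, z))) (at (\<gamma> t, z))"
    by (rule smooth_on_has_derivative[OF F z])
  moreover have "((\<lambda>\<tau>. (\<gamma> \<tau>, z)) has_derivative (\<lambda>h. h *\<^sub>R (e, 0))) (at t)"
    using \<gamma>[of t] by (auto simp: has_vector_derivative_def intro!: derivative_eq_intros)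
  ultimately have "((\<lambda>\<tau>. F (\<gamma> \<tau>, z)) has_derivative (\<lambda>h. dderiv (h *\<^sub>R (e, 0)) F (\<gamma> t, z))) (at t)"
    by (rule has_derivative_compose[rotated])
  then have "((\<lambda>\<tau>. \<theta> \<tau> z) has_derivative (\<lambda>h. dderiv (h *\<^sub>R (e, 0)) F (\<gamma> t, z))) (at t)"
    by (rule has_derivative_transform_within_open[OF _ op]) (use z agreesD[OF \<theta>] in auto)
  then have "((\<lambda>\<tau>. \<theta> \<tau> z) has_field_derivative dderiv (e, 0) F (\<gamma> t, z)) (at t)"
    unfolding linear_scale[OF linear_dderiv_on[OF F z]] has_field_derivative_def
    by (simp add: mult_commute_abs)
  then show "velocity \<theta> t z = dderiv (e, 0) F (\<gamma> t, z)"
    by (simp add: velocity_def DERIV_imp_deriv)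
qed

section \<open>Kaehler metric, gradient and covariant derivative on the slices\<close>

context fibre_potential
begin

lemma ddc_form_agrees:
  assumes f: "agrees W p f \<Phi>" and z: "(p, z) \<in> W"
  shows "ddc_form f z u v = \<omega> (p, z) (0, u) (0, v)"
proof -
  have "agrees W p (\<lambda>w. dc_form f w v) (dderiv (0, jvec v) \<Phi>)" for v
    unfolding agrees_def
  proof (intro allI impI)
    fix w assume w: "(p, w) \<in> W"
    have "dderiv (0, jvec v) \<Phi> (p, w) = dderiv ((- 1 / (2 * pi)) *\<^sub>R (0, \<i> *s v)) \<Phi> (p, w)"
      by (simp add: jvec_def)
    also have "\<dots> = (- 1 / (2 * pi)) * dderiv (0, \<i> *s v) \<Phi> (p, w)"
      by (simp only: linear_scale[OF linear_dderiv_on[OF smooth_pot w]] real_scaleR_def)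
    finally show "dc_form f w v = dderiv (0, jvec v) \<Phi> (p, w)"
      using agreesD[OF agrees_dderiv[OF open_W smooth_pot f] w] by (simp add: dc_form_eq)
  qed
  from agreesD[OF agrees_dderiv[OF open_W smooth_on_dderiv[OF smooth_pot] this] z]
  show ?thesis by (simp add: ddc_form_def ddj_def jfib_Pair dform_eq_dderiv)
qed

text \<open>A nonzero \<open>w\<close> pairs strictly positively with \<open>\<i> *s w\<close>, so
  it cannot pair to zero with the whole fibre.\<close>

lemma nondegenerate_ddc_pos:
  assumes f: "agrees W p f \<Phi>" and z: "(p, z) \<in> W" and pos: "ddc_pos f z"
  shows "nondegenerate \<Phi> (p, z)"
  unfolding nondegenerate_def
  using pos by (metis ddc_form_agrees[OF f z] ddc_pos_def less_irrefl)

end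

lemma i_mult_jvec: "\<i> *s jvec v = (1 / (2 * pi)) *\<^sub>R v"
  by (auto simp: jvec_def vec_eq_iff complex_eq_iff)

text \<open>The Poisson bracket written through \<open>kahler_grad\<close>, so that it refers to a
  single potential instead of a family.\<close>

definition fibre_bracket ::
    "(complex^'n \<Rightarrow> real) \<Rightarrow> (complex^'n \<Rightarrow> real) \<Rightarrow> (complex^'n \<Rightarrow> real) \<Rightarrow> complex^'n \<Rightarrow> real" where
  "fibre_bracket \<phi> f g z = dform g z (jvec (kahler_grad \<phi> f z))"

context nondegenerate_potential
begin

lemma kahler_metric_agrees:
  assumes "agrees W p \<phi> \<Phi>" "(p, z) \<in> W"
  shows "kahler_metric \<phi> z u v = 2 * pi * \<omega> (p, z) (0, u) (0, \<i> *s v)"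
  by (simp add: kahler_metric_def ddc_form_agrees[OF assms])

text \<open>The two defining conditions turn into each other on substituting \<open>jvec v\<close>
  or \<open>\<i> *s v\<close> for \<open>v\<close>; these substitutions are inverse up to the factor
  \<open>2 * pi\<close> contained in the metric.\<close>

lemma kahler_grad_agrees:
  assumes \<phi>: "agrees W p \<phi> \<Phi>" and f: "agrees W p f F" and F: "smooth_on F W" and z: "(p, z) \<in> W"
  shows "kahler_grad \<phi> f z = vgrad \<Phi> F (p, z)"
proof -
  have lw: "linear (\<lambda>v. \<omega> (p, z) (0, w) (0, v))" for w
    using linear_form_vertical(1)[OF z] .
  have ld: "dderiv (0, c *\<^sub>R v) F (p, z) = c * dderiv (0, v) F (p, z)" for c v
    using linear_scale[OF linear_dderiv_on[OF F z], of c "(0, v)"] by simp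
  have "(\<forall>v. kahler_metric \<phi> z w v = dform f z v)
      \<longleftrightarrow> (\<forall>v. \<omega> (p, z) (0, w) (0, v) = dderiv (0, jvec v) F (p, z))" (is "?l = ?r") for w
  proof -
    have l: "?l \<longleftrightarrow> (\<forall>v. 2 * pi * \<omega> (p, z) (0, w) (0, \<i> *s v) = dderiv (0, v) F (p, z))"
      by (simp add: kahler_metric_agrees[OF \<phi> z] dform_eq_dderiv
          agreesD[OF agrees_dderiv[OF open_W F f] z])
    show ?thesis
    proof
      assume ?l
      then have "2 * pi * \<omega> (p, z) (0, w) (0, \<i> *s jvec v) = dderiv (0, jvec v) F (p, z)" for v
        using l by blast
      then show ?r by (simp add: i_mult_jvec linear_scale[OF lw])
    next
      assume ?r
      then have "\<omega> (p, z) (0, w) (0, \<i> *s v) = dderiv (0, jvec (\<i> *s v)) F (p, z)" for v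
        by blast
      then show ?l unfolding l by (simp add: i_jvec ld)
    qed
  qed
  then show ?thesis by (simp add: kahler_grad_def vgrad_def)
qed

lemma grad_inner_agrees:
  assumes \<phi>: "agrees W p \<phi> \<Phi>" and f: "agrees W p f F" and F: "smooth_on F W"
    and g: "agrees W p g G" and G: "smooth_on G W" and z: "(p, z) \<in> W"
  shows "grad_inner \<phi> f g z = dderiv (0, vgrad \<Phi> G (p, z)) F (p, z)"
proof -
  have "grad_inner \<phi> f g z = 2 * pi * dderiv (0, jvec (\<i> *s vgrad \<Phi> G (p, z))) F (p, z)"
    by (simp add: grad_inner_def kahler_metric_agrees[OF \<phi> z] kahler_grad_agrees[OF \<phi> f F z]
        kahler_grad_agrees[OF \<phi> g G z] form_vgrad[OF z F])
  also have "(0, jvec (\<i> *s vgrad \<Phi> G (p, z))) = (1 / (2 * pi)) *\<^sub>R (0, vgrad \<Phi> G (p, z))"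
    by (simp add: i_jvec)
  finally show ?thesis
    by (simp only: linear_scale[OF linear_dderiv_on[OF F z]]) simp
qed

lemma agrees_bracket:
  assumes \<phi>: "agrees W p \<phi> \<Phi>" and f: "agrees W p f F" and F: "smooth_on F W"
    and g: "agrees W p g G" and G: "smooth_on G W"
  shows "agrees W p (fibre_bracket \<phi> f g) (bracket \<Phi> F G)"
  unfolding agrees_def fibre_bracket_def bracket_def hamiltonian_def dform_eq_dderiv
  using kahler_grad_agrees[OF \<phi> f F] agreesD[OF agrees_dderiv[OF open_W G g]] by simp

text \<open>By \<open>grad_inner_agrees\<close> the inner product is a derivative along the gradient
  of the velocity, so by linearity both terms of \<open>cov_deriv\<close> merge into one derivative
  along the lift of \<open>e\<close>.\<close>

lemma agrees_cov_deriv: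
  fixes \<gamma> :: "real \<Rightarrow> 'p"
  assumes \<phi>: "\<And>\<tau>. agrees W (\<gamma> \<tau>) (\<phi> \<tau>) \<Phi>" and \<theta>: "\<And>\<tau>. agrees W (\<gamma> \<tau>) (\<theta> \<tau>) F"
    and F: "smooth_on F W" and \<gamma>: "\<And>\<tau>. (\<gamma> has_vector_derivative e) (at \<tau>)"
  shows "agrees W (\<gamma> t) (cov_deriv \<phi> \<theta> t) (\<lambda>y. dderiv (horizontal \<Phi> e y) F y)"
  unfolding agrees_def
proof (intro allI impI)
  fix z assume z: "(\<gamma> t, z) \<in> W"
  let ?g = "vgrad \<Phi> (dderiv (e, 0) \<Phi>) (\<gamma> t, z)"
  note v\<phi> = agrees_velocity[OF open_W smooth_pot \<phi> \<gamma>, of t]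
  have "cov_deriv \<phi> \<theta> t z = dderiv (e, 0) F (\<gamma> t, z) - dderiv (0, ?g) F (\<gamma> t, z)"
    using agreesD[OF agrees_velocity[OF open_W F \<theta> \<gamma>] z]
      grad_inner_agrees[OF \<phi> \<theta> F v\<phi> smooth_on_dderiv[OF smooth_pot] z]
    by (simp add: cov_deriv_def)
  also have "\<dots> = dderiv ((e, 0) - (0, ?g)) F (\<gamma> t, z)"
    by (simp only: linear_diff[OF linear_dderiv_on[OF F z]])
  also have "(e, 0) - (0, ?g) = horizontal \<Phi> e (\<gamma> t, z)"
    by (simp add: horizontal_def)
  finally show "cov_deriv \<phi> \<theta> t z = dderiv (horizontal \<Phi> e (\<gamma> t, z)) F (\<gamma> t, z)" .
qed

end

section \<open>Curvature as an iterated Poisson bracket\<close>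

lemma cov_commutator_eq_bracket:
  assumes "nondegenerate_potential W \<Phi>" and \<psi>: "smooth_on \<Psi> W"
    and \<phi>: "\<And>t s. agrees W (t, s) (\<phi> t s) \<Phi>" and \<theta>: "\<And>t s. agrees W (t, s) (\<psi> t s) \<Psi>"
    and z: "((t, s), z) \<in> W"
  shows "cov_commutator \<phi> \<psi> t s z = 4 * pi\<^sup>2 * bracket \<Phi>
    (bracket \<Phi> (dderiv ((1, 0), 0) \<Phi>) (dderiv ((0, 1), 0) \<Phi>)) \<Psi> ((t, s), z)"
proof -
  interpret nondegenerate_potential W \<Phi> by fact
  have path1: "((\<lambda>\<tau>. (\<tau>, b)) has_vector_derivative (1, 0)) (at \<tau>)" for b \<tau> :: real
    by (auto simp: has_vector_derivative_def intro!: derivative_eq_intros)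
  have path2: "((\<lambda>\<tau>. (a, \<tau>)) has_vector_derivative (0, 1)) (at \<tau>)" for a \<tau> :: real
    by (auto simp: has_vector_derivative_def intro!: derivative_eq_intros)
  \<comment> \<open>Stated for all parameters, since the result of one covariant derivative is fed
    as a family into the other.\<close>
  have D1: "agrees W (t, s) (cov_deriv (\<lambda>\<tau>. \<phi> \<tau> s) (\<lambda>\<tau>. \<theta> \<tau> s) t)
      (\<lambda>y. dderiv (horizontal \<Phi> (1, 0) y) F y)"
    if "\<And>t s. agrees W (t, s) (\<theta> t s) F" "smooth_on F W" for \<theta> F t s
    by (rule agrees_cov_deriv[where \<gamma> = "\<lambda>\<tau>. (\<tau>, s)", OF \<phi> that path1])
  have D2: "agrees W (t, s) (cov_deriv (\<phi> t) (\<theta> t) s) (\<lambda>y. dderiv (horizontal \<Phi> (0, 1) y) F y)"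
    if "\<And>t s. agrees W (t, s) (\<theta> t s) F" "smooth_on F W" for \<theta> F t s
    by (rule agrees_cov_deriv[where \<gamma> = "\<lambda>\<tau>. (t, \<tau>)", OF \<phi> that path2])
  show ?thesis
    using agreesD[OF D1[OF D2[OF \<theta> \<psi>] smooth_horizontal_deriv[OF \<psi>]] z]
      agreesD[OF D2[OF D1[OF \<theta> \<psi>] smooth_horizontal_deriv[OF \<psi>]] z]
      horizontal_commutator[OF z \<psi>, of "(1, 0)" "(0, 1)"]
    by (simp add: cov_commutator_def)
qed

text \<open>The right-hand side now refers only to data at the parameter \<open>(t, s)\<close>, so
  commutators along different families can be compared.\<close>

lemma cov_commutator_eq_fibre_bracket:
  assumes pot: "nondegenerate_potential W \<Phi>" and \<psi>: "smooth_on \<Psi> W"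
    and \<phi>: "\<And>t s. agrees W (t, s) (\<phi> t s) \<Phi>" and \<theta>: "\<And>t s. agrees W (t, s) (\<psi> t s) \<Psi>"
    and z: "((t, s), z) \<in> W"
  shows "cov_commutator \<phi> \<psi> t s z = 4 * pi\<^sup>2 * fibre_bracket (\<phi> t s)
    (fibre_bracket (\<phi> t s) (velocity (\<lambda>\<tau>. \<phi> \<tau> s) t) (velocity (\<phi> t) s)) (\<psi> t s) z"
proof -
  interpret nondegenerate_potential W \<Phi> by fact
  have "((\<lambda>\<tau>. (\<tau>, s)) has_vector_derivative (1, 0)) (at \<tau>)" for \<tau> :: real
    by (auto simp: has_vector_derivative_def intro!: derivative_eq_intros)
  from agrees_velocity[where \<gamma> = "\<lambda>\<tau>. (\<tau>, s)", OF open_W smooth_pot \<phi> this]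
  have v1: "agrees W (t, s) (velocity (\<lambda>\<tau>. \<phi> \<tau> s) t) (dderiv ((1, 0), 0) \<Phi>)" .
  have "((\<lambda>\<tau>. (t, \<tau>)) has_vector_derivative (0, 1)) (at \<tau>)" for \<tau> :: real
    by (auto simp: has_vector_derivative_def intro!: derivative_eq_intros)
  from agrees_velocity[where \<gamma> = "\<lambda>\<tau>. (t, \<tau>)", OF open_W smooth_pot \<phi> this]
  have v2: "agrees W (t, s) (velocity (\<phi> t) s) (dderiv ((0, 1), 0) \<Phi>)" .
  note D = smooth_on_dderiv[OF smooth_pot]
  show ?thesis
    using agreesD[OF agrees_bracket[OF \<phi> agrees_bracket[OF \<phi> v1 D v2 D] smooth_bracket[OF D D] \<theta> \<psi>] z]
      cov_commutator_eq_bracket[OF pot \<psi> \<phi> \<theta> z] by simp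
qed

lemma fibre_potentialI: "open W \<Longrightarrow> smooth_on \<Phi> W \<Longrightarrow> fibre_potential W \<Phi>"
  by (intro fibre_potential.intro potential.intro linear_jfib)

lemma nondegenerate_potential_restrict:
  assumes "open W" "smooth_on \<Phi> W"
  shows "nondegenerate_potential {x \<in> W. nondegenerate \<Phi> x} \<Phi>"
proof -
  interpret fibre_potential W \<Phi>
    using assms by (rule fibre_potentialI)
  show ?thesis
    by (intro nondegenerate_potential.intro nondegenerate_potential_axioms.intro fibre_potentialI
        open_nondegenerate smooth_on_subset[OF assms(2)]) auto
qed

text \<open>This is the commutator formula for the affine family at the parameter
  \<open>(0, 0)\<close>, where the velocities are \<open>\<xi>\<close> and
  \<open>\<eta>\<close>.\<close>

lemma mabuchi_curvature_eq_fibre_bracket: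
  fixes \<phi> :: "complex^'n \<Rightarrow> real"
  assumes V: "open V" "z \<in> V"
    and sm: "smooth_on \<phi> V" "smooth_on \<xi> V" "smooth_on \<eta> V" "smooth_on \<zeta> V"
    and nd: "\<And>w. (\<And>v. ddc_form \<phi> z w v = 0) \<Longrightarrow> w = 0"
  shows "mabuchi_curvature \<phi> \<xi> \<eta> \<zeta> z
    = 4 * pi\<^sup>2 * fibre_bracket \<phi> (fibre_bracket \<phi> \<xi> \<eta>) \<zeta> z"
proof -
  define W0 where "W0 = (UNIV :: (real \<times> real) set) \<times> V"
  define \<Phi> where "\<Phi> x = \<phi> (snd x) + fst (fst x) * \<xi> (snd x) + snd (fst x) * \<eta> (snd x)"
    for x :: "(real \<times> real) \<times> (complex^'n)"
  have W0: "open W0" using V by (simp add: W0_def open_Times)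
  have snd: "smooth_on (\<lambda>x. f (snd x)) W0" if "smooth_on f V" for f
    using smooth_on_compose_affine[OF bounded_linear_snd that W0, of 0] by (auto simp: W0_def)
  have coord: "smooth_on (\<lambda>x. fst (fst x)) W0" "smooth_on (\<lambda>x. snd (fst x)) W0"
    by (intro smooth_on_linear bounded_linear_fst_comp bounded_linear_snd_comp bounded_linear_ident)+
  have \<Phi>: "smooth_on \<Phi> W0"
    unfolding \<Phi>_def by (intro smooth_on_add smooth_on_mult W0 coord snd sm)
  \<comment> \<open>The affine family may degenerate away from the parameter \<open>(0, 0)\<close>,
    hence the restriction to an open set on which it does not.\<close>
  define W where "W = {x \<in> W0. nondegenerate \<Phi> x}"
  have pot: "nondegenerate_potential W \<Phi>"
    unfolding W_def by (rule nondegenerate_potential_restrict[OF W0 \<Phi>])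
  interpret fp: fibre_potential W0 \<Phi>
    using W0 \<Phi> by (rule fibre_potentialI)
  let ?\<phi> = "\<lambda>t s z. \<phi> z + t * \<xi> z + s * \<eta> z"
  have ag: "agrees A (t, s) (?\<phi> t s) \<Phi>" for A t s
    by (simp add: agrees_def \<Phi>_def)
  have "((0, 0), z) \<in> W0" using V by (simp add: W0_def)
  moreover from this have "nondegenerate \<Phi> ((0, 0), z)"
    using nd fp.ddc_form_agrees[OF ag, of 0 0 z] unfolding nondegenerate_def by simp
  ultimately have z: "((0, 0), z) \<in> W" by (simp add: W_def)
  have "velocity (\<lambda>\<tau>. ?\<phi> \<tau> 0) 0 = \<xi>" "velocity (?\<phi> 0) 0 = \<eta>"
    by (auto simp: velocity_def fun_eq_iff intro!: DERIV_imp_deriv derivative_eq_intros)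
  moreover have "smooth_on (\<lambda>x. \<zeta> (snd x)) W"
    by (rule smooth_on_subset[OF snd[OF sm(4)]]) (auto simp: W_def)
  ultimately show ?thesis
    using cov_commutator_eq_fibre_bracket[OF pot _ ag _ z, of "\<lambda>x. \<zeta> (snd x)" "\<lambda>t s. \<zeta>"]
    by (simp add: mabuchi_curvature_def agrees_def)
qed

text \<open>Allows arbitrary smooth functions and not only velocities, because the curvature is also
  evaluated on covariant derivatives.\<close>

lemma (in nondegenerate_potential) agrees_mabuchi_curvature:
  assumes \<phi>: "agrees W p \<phi> \<Phi>" and \<xi>: "agrees W p \<xi> X" "smooth_on X W"
    and \<eta>: "agrees W p \<eta> Y" "smooth_on Y W" and \<zeta>: "agrees W p \<zeta> Z" "smooth_on Z W"
  shows "agrees W p (mabuchi_curvature \<phi> \<xi> \<eta> \<zeta>)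
    (\<lambda>x. 4 * pi\<^sup>2 * bracket \<Phi> (bracket \<Phi> X Y) Z x)"
  unfolding agrees_def
proof (intro allI impI)
  fix z assume z: "(p, z) \<in> W"
  have "mabuchi_curvature \<phi> \<xi> \<eta> \<zeta> z = 4 * pi\<^sup>2 * fibre_bracket \<phi> (fibre_bracket \<phi> \<xi> \<eta>) \<zeta> z"
  proof (rule mabuchi_curvature_eq_fibre_bracket[OF open_slice[OF open_W, of p]])
    show "w = 0" if "\<And>v. ddc_form \<phi> z w v = 0" for w
      using nondeg[OF z] that by (simp add: nondegenerate_def ddc_form_agrees[OF \<phi> z])
  qed (use z agrees_smooth[OF open_W] smooth_pot assms in auto)
  then show "mabuchi_curvature \<phi> \<xi> \<eta> \<zeta> z = 4 * pi\<^sup>2 * bracket \<Phi> (bracket \<Phi> X Y) Z (p, z)"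
    using agreesD[OF agrees_bracket[OF \<phi> agrees_bracket[OF \<phi> \<xi> \<eta>] smooth_bracket \<zeta>] z] \<xi> \<eta> by simp
qed

text \<open>The Leibniz rule is used twice, for the outer and then for the inner bracket. The three
  summands match the three correction terms of \<open>cov_deriv_curvature\<close>.\<close>

lemma (in nondegenerate_potential) horizontal_iterated_bracket:
  assumes x: "x \<in> W" and A: "smooth_on A W" and B: "smooth_on B W" and C: "smooth_on C W"
  shows "dderiv (horizontal \<Phi> e x) (\<lambda>y. c * bracket \<Phi> (bracket \<Phi> A B) C y) x
    = c * bracket \<Phi> (bracket \<Phi> (\<lambda>y. dderiv (horizontal \<Phi> e y) A y) B) C x
    + c * bracket \<Phi> (bracket \<Phi> A (\<lambda>y. dderiv (horizontal \<Phi> e y) B y)) C x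
    + c * bracket \<Phi> (bracket \<Phi> A B) (\<lambda>y. dderiv (horizontal \<Phi> e y) C y) x"
proof -
  let ?D = "\<lambda>f y. dderiv (horizontal \<Phi> e y) f y"
  note sm = smooth_bracket smooth_horizontal_deriv A B C
  have "dderiv (horizontal \<Phi> e x) (\<lambda>y. c * bracket \<Phi> (bracket \<Phi> A B) C y) x
      = c * dderiv (horizontal \<Phi> e x) (bracket \<Phi> (bracket \<Phi> A B) C) x"
    by (rule dderiv_eq) (intro has_derivative_mult_right smooth_on_has_derivative[OF _ x] sm)
  also have "dderiv (horizontal \<Phi> e x) (bracket \<Phi> (bracket \<Phi> A B) C) x
      = bracket \<Phi> (?D (bracket \<Phi> A B)) C x + bracket \<Phi> (bracket \<Phi> A B) (?D C) x"
    by (intro horizontal_bracket x sm)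
  also have "bracket \<Phi> (?D (bracket \<Phi> A B)) C x
      = bracket \<Phi> (\<lambda>y. bracket \<Phi> (?D A) B y + bracket \<Phi> A (?D B) y) C x"
    by (rule bracket_cong_left[OF open_W x horizontal_bracket[OF _ A B]])
  also have "\<dots> = bracket \<Phi> (bracket \<Phi> (?D A) B) C x + bracket \<Phi> (bracket \<Phi> A (?D B)) C x"
    by (intro bracket_add_left x sm)
  finally show ?thesis by (simp add: algebra_simps)
qed

section \<open>Families of strictly plurisubharmonic functions\<close>

lemma nondegenerate_family:
  fixes F G :: "'p::euclidean_space \<Rightarrow> complex^'n \<Rightarrow> real"
  assumes "smooth_family P \<Omega> F" "smooth_family P \<Omega> G"
    and "\<And>p. p \<in> P \<Longrightarrow> F p \<in> strictly_psh \<Omega>"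
  obtains W where "nondegenerate_potential W (\<lambda>(p, z). F p z)"
    "smooth_on (\<lambda>(p, z). G p z) W" "P \<times> closure \<Omega> \<subseteq> W"
proof -
  obtain W1 W2 where W1: "open W1" "P \<times> closure \<Omega> \<subseteq> W1" "smooth_on (\<lambda>(p, z). F p z) W1"
    and W2: "open W2" "P \<times> closure \<Omega> \<subseteq> W2" "smooth_on (\<lambda>(p, z). G p z) W2"
    using assms unfolding smooth_family_def by blast
  define W where "W = W1 \<inter> W2"
  define \<Phi> where "\<Phi> = (\<lambda>(p, z). F p z)"
  have W: "open W" "smooth_on \<Phi> W"
    using W1 W2 smooth_on_subset unfolding W_def \<Phi>_def by blast+
  interpret fibre_potential W \<Phi>
    using W by (rule fibre_potentialI)
  show ?thesis
  proof
    show "nondegenerate_potential {x \<in> W. nondegenerate \<Phi> x} (\<lambda>(p, z). F p z)"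
      using nondegenerate_potential_restrict[OF W] by (simp add: \<Phi>_def)
    show "smooth_on (\<lambda>(p, z). G p z) {x \<in> W. nondegenerate \<Phi> x}"
      by (rule smooth_on_subset[OF W2(3)]) (auto simp: W_def)
    \<comment> \<open>Positivity is available over \<open>P \<times> closure \<Omega>\<close>; hence
      that set survives when \<open>W\<close> is cut down to its nondegenerate points.\<close>
    have "nondegenerate \<Phi> (p, z)" if "p \<in> P" "z \<in> closure \<Omega>" for p z
    proof (rule nondegenerate_ddc_pos)
      show "agrees W p (F p) \<Phi>" by (simp add: agrees_def \<Phi>_def)
      show "(p, z) \<in> W" using that W1 W2 by (auto simp: W_def)
      show "ddc_pos (F p) z" using assms(3) that by (auto simp: strictly_psh_def)
    qed
    then show "P \<times> closure \<Omega> \<subseteq> {x \<in> W. nondegenerate \<Phi> x}"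
      using W1 W2 by (auto simp: W_def)
  qed
qed

text \<open>The commutator along the given family and the one along the affine family through the
  same velocities are the same iterated bracket.\<close>

lemma is_curvature_tensor_mabuchi:
  fixes \<Omega> :: "(complex^'n) set"
  shows "is_curvature_tensor \<Omega> mabuchi_curvature"
  unfolding is_curvature_tensor_def
proof (intro allI impI, elim conjE, clarify)
  fix P and \<phi> \<psi> :: "real \<Rightarrow> real \<Rightarrow> complex^'n \<Rightarrow> real" and t s z
  assume fam: "smooth_family P \<Omega> (\<lambda>(t, s). \<phi> t s)" "smooth_family P \<Omega> (\<lambda>(t, s). \<psi> t s)"
    and psh: "\<forall>(t, s)\<in>P. \<phi> t s \<in> strictly_psh \<Omega>" and P: "(t, s) \<in> P" "z \<in> closure \<Omega>"
  have "\<And>p. p \<in> P \<Longrightarrow> (case p of (t, s) \<Rightarrow> \<phi> t s) \<in> strictly_psh \<Omega>"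
    using psh by auto
  from nondegenerate_family[OF fam this] obtain W where
    pot: "nondegenerate_potential W (\<lambda>(p, z). (case p of (t, s) \<Rightarrow> \<phi> t s) z)" and
    \<psi>: "smooth_on (\<lambda>(p, z). (case p of (t, s) \<Rightarrow> \<psi> t s) z) W" and
    W: "P \<times> closure \<Omega> \<subseteq> W" by metis
  interpret nondegenerate_potential W "\<lambda>(p, z). (case p of (t, s) \<Rightarrow> \<phi> t s) z" by fact
  have z: "((t, s), z) \<in> W" using W P by auto
  have ag: "agrees W (t, s) (f t s) (\<lambda>(p, z). (case p of (t, s) \<Rightarrow> f t s) z)" for f t s
    by (simp add: agrees_def)
  have "((\<lambda>\<tau>. (\<tau>, s)) has_vector_derivative (1, 0)) (at \<tau>)" for \<tau> :: real
    by (auto simp: has_vector_derivative_def intro!: derivative_eq_intros)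
  note v1 = agrees_velocity[where \<gamma> = "\<lambda>\<tau>. (\<tau>, s)", OF open_W smooth_pot ag this, of t]
  have "((\<lambda>\<tau>. (t, \<tau>)) has_vector_derivative (0, 1)) (at \<tau>)" for \<tau> :: real
    by (auto simp: has_vector_derivative_def intro!: derivative_eq_intros)
  note v2 = agrees_velocity[where \<gamma> = "\<lambda>\<tau>. (t, \<tau>)", OF open_W smooth_pot ag this, of s]
  note D = smooth_on_dderiv[OF smooth_pot]
  show "mabuchi_curvature (\<phi> t s) (velocity (\<lambda>\<tau>. \<phi> \<tau> s) t) (velocity (\<phi> t) s) (\<psi> t s) z
      = cov_commutator \<phi> \<psi> t s z"
    using agreesD[OF agrees_mabuchi_curvature[OF ag v1 D v2 D ag \<psi>] z]
      cov_commutator_eq_bracket[OF pot \<psi> ag ag z] by simp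
qed

text \<open>On the total space \<open>D\<^sub>r\<close> is the derivative along a horizontal lift,
  so the covariant derivative of the curvature measures the failure of the Leibniz rule for the
  iterated bracket, which is zero.\<close>

lemma parallel_curvature_mabuchi:
  fixes \<Omega> :: "(complex^'n) set"
  shows "parallel_curvature \<Omega> mabuchi_curvature"
  unfolding parallel_curvature_def
proof (intro allI impI, elim conjE, clarify)
  fix P and \<phi> \<psi> :: "real \<Rightarrow> real \<Rightarrow> real \<Rightarrow> complex^'n \<Rightarrow> real" and t s r z
  assume fam: "smooth_family P \<Omega> (\<lambda>(t, s, r). \<phi> t s r)" "smooth_family P \<Omega> (\<lambda>(t, s, r). \<psi> t s r)"
    and psh: "\<forall>(t, s, r)\<in>P. \<phi> t s r \<in> mabuchi_space \<Omega> \<and> \<psi> t s r \<in> mabuchi_tangent \<Omega>"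
    and P: "(t, s, r) \<in> P" "z \<in> closure \<Omega>"
  have "\<And>p. p \<in> P \<Longrightarrow> (case p of (t, s, r) \<Rightarrow> \<phi> t s r) \<in> strictly_psh \<Omega>"
    using psh by (auto simp: mabuchi_space_def)
  from nondegenerate_family[OF fam this] obtain W where
    pot: "nondegenerate_potential W (\<lambda>(p, z). (case p of (t, s, r) \<Rightarrow> \<phi> t s r) z)" and
    \<psi>: "smooth_on (\<lambda>(p, z). (case p of (t, s, r) \<Rightarrow> \<psi> t s r) z) W" and
    W: "P \<times> closure \<Omega> \<subseteq> W" by metis
  define \<Phi> where "\<Phi> = (\<lambda>(p, z). (case p of (t, s, r) \<Rightarrow> \<phi> t s r) z)"
  define \<Psi> where "\<Psi> = (\<lambda>(p, z). (case p of (t, s, r) \<Rightarrow> \<psi> t s r) z)"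
  interpret nondegenerate_potential W \<Phi> using pot by (simp add: \<Phi>_def)
  have \<Psi>: "smooth_on \<Psi> W" using \<psi> by (simp add: \<Psi>_def)
  have z: "((t, s, r), z) \<in> W" using W P by auto
  have \<phi>: "agrees W (t, s, r) (\<phi> t s r) \<Phi>" and \<psi>: "agrees W (t, s, r) (\<psi> t s r) \<Psi>" for t s r
    by (simp_all add: agrees_def \<Phi>_def \<Psi>_def)
  define \<phi>t where "\<phi>t = (\<lambda>\<rho>. velocity (\<lambda>\<tau>. \<phi> \<tau> s \<rho>) t)"
  define \<phi>s where "\<phi>s = (\<lambda>\<rho>. velocity (\<lambda>\<sigma>. \<phi> t \<sigma> \<rho>) s)"
  define A where "A = dderiv ((1, 0, 0), 0) \<Phi>"
  define B where "B = dderiv ((0, 1, 0), 0) \<Phi>"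
  have A: "smooth_on A W" and B: "smooth_on B W"
    unfolding A_def B_def by (intro smooth_on_dderiv smooth_pot)+
  have "((\<lambda>\<tau>. (\<tau>, s, \<rho>)) has_vector_derivative (1, 0, 0)) (at \<tau>)" for \<tau> \<rho> :: real
    by (auto simp: has_vector_derivative_def zero_prod_def intro!: derivative_eq_intros)
  from agrees_velocity[where \<gamma> = "\<lambda>\<tau>. (\<tau>, s, _)", OF open_W smooth_pot \<phi> this, of t]
  have \<phi>t: "agrees W (t, s, \<rho>) (\<phi>t \<rho>) A" for \<rho> by (simp add: \<phi>t_def A_def)
  have "((\<lambda>\<tau>. (t, \<tau>, \<rho>)) has_vector_derivative (0, 1, 0)) (at \<tau>)" for \<tau> \<rho> :: real
    by (auto simp: has_vector_derivative_def zero_prod_def intro!: derivative_eq_intros)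
  from agrees_velocity[where \<gamma> = "\<lambda>\<tau>. (t, \<tau>, _)", OF open_W smooth_pot \<phi> this, of s]
  have \<phi>s: "agrees W (t, s, \<rho>) (\<phi>s \<rho>) B" for \<rho> by (simp add: \<phi>s_def B_def)
  have path: "((\<lambda>\<tau>. (t, s, \<tau>)) has_vector_derivative (0, 0, 1)) (at \<tau>)" for \<tau> :: real
    by (auto simp: has_vector_derivative_def zero_prod_def intro!: derivative_eq_intros)
  let ?D = "\<lambda>F y. dderiv (horizontal \<Phi> (0, 0, 1) y) F y"
  \<comment> \<open>Kept general in \<open>\<theta>\<close> because it is applied to the curvature
    itself, to both velocities and to \<open>\<psi>\<close>.\<close>
  have Dr: "agrees W (t, s, r) (cov_deriv (\<phi> t s) \<theta> r) (?D F)"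
    if "\<And>\<rho>. agrees W (t, s, \<rho>) (\<theta> \<rho>) F" "smooth_on F W" for \<theta> F
    by (rule agrees_cov_deriv[where \<gamma> = "\<lambda>\<tau>. (t, s, \<tau>)", OF \<phi> that path])
  have smooth_R: "smooth_on (\<lambda>x. 4 * pi\<^sup>2 * bracket \<Phi> (bracket \<Phi> A B) \<Psi> x) W"
    by (intro smooth_on_mult smooth_on_const open_W smooth_bracket A B \<Psi>)
  note R = agreesD[OF agrees_mabuchi_curvature z]
  note SD = smooth_horizontal_deriv
  show "cov_deriv_curvature mabuchi_curvature \<phi> \<psi> t s r z = 0"
    unfolding cov_deriv_curvature_def Let_def \<phi>t_def[symmetric] \<phi>s_def[symmetric]
      agreesD[OF Dr[OF agrees_mabuchi_curvature[OF \<phi> \<phi>t A \<phi>s B \<psi> \<Psi>] smooth_R] z]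
      R[OF \<phi> Dr[OF \<phi>t A] SD[OF A] \<phi>s B \<psi> \<Psi>]
      R[OF \<phi> \<phi>t A Dr[OF \<phi>s B] SD[OF B] \<psi> \<Psi>]
      R[OF \<phi> \<phi>t A \<phi>s B Dr[OF \<psi> \<Psi>] SD[OF \<Psi>]]
      horizontal_iterated_bracket[OF z A B \<Psi>]
    by simp
qed

theorem theoremA:
  fixes \<Omega> :: "(complex^'n) set"
  assumes "smooth_bounded_strongly_pseudoconvex \<Omega>"
  shows "is_curvature_tensor \<Omega> mabuchi_curvature \<and> parallel_curvature \<Omega> mabuchi_curvature"
  by (simp add: is_curvature_tensor_mabuchi parallel_curvature_mabuchi)

end
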